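(* Let $T=\mathbb{Z}$ or $T=\mathbb{R}$ and let $\alpha\in(0,2)$. Suppose that a stationary S$\alpha$S process $X_\alpha=\{X_\alpha(t)\}_{t\in T}$ (real-valued or complex-valued) is generated by a periodic flow. Then $X_\alpha$ can be represented in distribution (equality of finite-dimensional distributions) as the sum of two independent stationary S$\alpha$S processes. The first is $$\int_{\widehat T} e^{itx}\,N_\alpha(dx)\ \text{(complex-valued case)},\qquad \int_{\{1\}}N_\alpha(dx)+n(t)\int_{\{2\}}N_\alpha(dx)\ \text{(real-valued case)},$$ where the S$\alpha$S random measure $N_\alpha$ has a finite control measure $\eta(dx)$ (on $\widehat T$, respectively on $\{1,2\}$). The second can be represented as $$\int_Z\int_{[0,q(z))} b_1(z)^{[v+t]_{q(z)}}\,g(z,\{v+t\}_{q(z)})\,M_\alpha(dz,dv),$$ where $(Z,\mathcal Z,\sigma)$ is a standard Lebesgue space, $q(z)\in T_+$ a.e. $\sigma(dz)$, $g\in L^\alpha(Z\times[0,q(\cdot)),\sigma(dz)\lambda(dv))$ and $b_1(z)\in\{-1,1\}$ (or $b_1(z)\in\{w\in\mathbb{C}:|w|=1\}$ in the complex-valued case) are measurable functions, and the S$\alpha$S random measure $M_\alpha$ has control measure $\sigma(dz)\lambda(dv)$.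
   Context: Notation. $\lambda$ is counting measure on $\mathbb{Z}$ if $T=\mathbb{Z}$ and Lebesgue measure if $T=\mathbb{R}$. $\widehat T=\mathbb{R}$ if $T=\mathbb{R}$ and $\widehat T=[0,2\pi)$ if $T=\mathbb{Z}$. $n(t)=0$ if $T=\mathbb{R}$, $n(t)=(-1)^t$ if $T=\mathbb{Z}$. $T_+=(0,\infty)$ if $T=\mathbb{R}$, $T_+=\{2,3,\dots\}$ if $T=\mathbb{Z}$. For $a>0$, $x\in\mathbb{R}$: $[x]_a=\max\{n\in\mathbb{Z}:na\le x\}$ and $\{x\}_a=x-a[x]_a$. $Z\times[0,q(\cdot))=\{(z,v):z\in Z,\,0\le v<q(z)\}$. A standard Lebesgue space is a standard Borel space with a $\sigma$-finite measure. For a S$\alpha$S random measure $M_\alpha$ with control measure $\nu$ on a standard Lebesgue space $(S,\mathcal S,\nu)$ (real-valued, or complex-valued and rotationally invariant) and functions $f_t\in L^\alpha(S,\mathcal S,\nu)$ (real- or complex-valued accordingly) with $(t,s)\mapsto f_t(s)$ measurable, the process $\int_S f_t\,dM_\alpha$ has finite-dimensional distributions determined by $E\exp\{i\sum_k\theta_kX(t_k)\}=\exp\{-\int_S|\sum_k\theta_kf_{t_k}|^\alpha d\nu\}$, $\theta_k\in\mathbb{R}$ (real-valued case), or $E\exp\{i\sum_k\Re(\overline{\theta_k}X(t_k))\}=\exp\{-c_0\int_S|\sum_k\overline{\theta_k}f_{t_k}|^\alpha d\nu\}$, $\theta_k\in\mathbb{C}$, $c_0=(2\pi)^{-1}\int_0^{2\pi}|\cos\phi|^\alpha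 d\phi$ (complex-valued case). All S$\alpha$S processes considered have such a representation $\{X_\alpha(t)\}_{t\in T}\stackrel{d}{=}\{\int_Sf_t\,dM_\alpha\}_{t\in T}$. Flows. A flow $\{\phi_t\}_{t\in T}$ on $(S,\mathcal S,\nu)$ is a family of maps $\phi_t:S\to S$ with $\phi_0(s)=s$, $\phi_{t_1+t_2}=\phi_{t_1}\circ\phi_{t_2}$; it is measurable if $(t,s)\mapsto\phi_t(s)$ is measurable and nonsingular if for every $t$, $\nu(N)=0\iff\nu(\phi_t^{-1}(N))=0$. A cocycle for $\{\phi_t\}$ with values in a group $A$ is a measurable map $(t,s)\mapsto a_t(s)\in A$ with $a_{t_1+t_2}(s)=a_{t_1}(s)a_{t_2}(\phi_{t_1}(s))$ for all $t_1,t_2,s$. A measurable flow is periodic if $S=P$ $\nu$-a.e., where $P=\{s:\exists\,p\in T\setminus\{0\},\ \phi_p(s)=s\}$. Generated by a flow. A stationary S$\alpha$S process with a representation $\{X_\alpha(t)\}_{t\in T}\stackrel{d}{=}\{\int_S f_t\,dM_\alpha\}_{t\in T}$, where $M_\alpha$ is a S$\alpha$S random measure with control measure $\nu$ on a standard Lebesgue space $(S,\mathcal S,\nu)$, $\{f_t\}_{t\in T}\subset L^\alpha(S,\mathcal S,\nu)$ and $(t,s)\mapsto f_t(s)$ is measurable, is generated by a nonsingular measurable flow $\{\phi_t\}_{t\in T}$ on $(S,\mathcal S,\nu)$ if for all $t\in T$, $f_t(s)=a_t(s)\{\frac{d(\nu\circ\phi_t)}{d\nu}(s)\}^{1/\alpha}f_0(\phi_t(s))$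 a.e. $\nu(ds)$, where $f_0\in L^\alpha(S,\mathcal S,\nu)$, $\{a_t\}$ is a cocycle for $\{\phi_t\}$ with values in $\{-1,1\}$ (real-valued case) or $\{|w|=1\}$ (complex-valued case), and $\mathrm{supp}\{f_t,t\in T\}=S$ $\nu$-a.e.; here the support is the minimal (a.e.) set $A\in\mathcal S$ with $\nu\{s\notin A:f_t(s)\ne0\}=0$ for every $t\in T$. *)

theory Defs
  imports "HOL-Probability.Probability"
begin

text \<open>
  Time is a set \<open>T\<close> of reals, either \<open>\<int>\<close> or \<open>UNIV\<close>. Processes, flows and kernels are
  functions on all of \<open>real\<close>, constrained only at arguments in \<open>T\<close>.
\<close>

definition time_measure :: "real set \<Rightarrow> real measure" where
  "time_measure T = (if T = \<int> then count_space \<int> else lborel)"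

definition dual_time :: "real set \<Rightarrow> real set" where
  "dual_time T = (if T = \<int> then {0..<2 * pi} else UNIV)"

definition alternating :: "real set \<Rightarrow> real \<Rightarrow> real" where
  "alternating T t = (if T = \<int> then (-1) powi \<lfloor>t\<rfloor> else 0)"

definition period_range :: "real set \<Rightarrow> real set" where
  "period_range T = (if T = \<int> then {t \<in> \<int>. 2 \<le> t} else {0<..})"

definition int_quot :: "real \<Rightarrow> real \<Rightarrow> int" where
  "int_quot a x = (GREATEST n. of_int n * a \<le> x)"

definition real_rem :: "real \<Rightarrow> real \<Rightarrow> real" where
  "real_rem a x = x - a * of_int (int_quot a x)"


definition standard_borel :: "'a measure \<Rightarrow> bool" where
  "standard_borel M \<longleftrightarrow> (\<exists>X. completely_metrizable_space X \<and> second_countable X \<and>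
     topspace X = space M \<and> sets M = sigma_sets (topspace X) {U. openin X U})"

definition standard_lebesgue :: "'a measure \<Rightarrow> bool" where
  "standard_lebesgue M \<longleftrightarrow> standard_borel M \<and> sigma_finite_measure M"

definition in_Lalpha :: "real \<Rightarrow> 'a measure \<Rightarrow> ('a \<Rightarrow> 'k::{banach, second_countable_topology}) \<Rightarrow> bool" where
  "in_Lalpha \<alpha> M h \<longleftrightarrow> h \<in> borel_measurable M \<and> integrable M (\<lambda>s. norm (h s) powr \<alpha>)"


definition stoch_process :: "real set \<Rightarrow> 'w measure \<Rightarrow> (real \<Rightarrow> 'w \<Rightarrow> 'k::topological_space) \<Rightarrow> bool" where
  "stoch_process T P X \<longleftrightarrow> prob_space P \<and> (\<forall>t\<in>T. X t \<in> borel_measurable P)"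

definition same_fdd ::
  "real set \<Rightarrow> 'v measure \<Rightarrow> (real \<Rightarrow> 'v \<Rightarrow> 'k::topological_space) \<Rightarrow>
   'w measure \<Rightarrow> (real \<Rightarrow> 'w \<Rightarrow> 'k) \<Rightarrow> bool" where
  "same_fdd T P X Q Y \<longleftrightarrow> (\<forall>J. finite J \<and> J \<subseteq> T \<longrightarrow>
     distr P (PiM J (\<lambda>_. borel)) (\<lambda>\<omega>. \<lambda>t\<in>J. X t \<omega>) =
     distr Q (PiM J (\<lambda>_. borel)) (\<lambda>\<omega>. \<lambda>t\<in>J. Y t \<omega>))"

definition stationary :: "real set \<Rightarrow> 'w measure \<Rightarrow> (real \<Rightarrow> 'w \<Rightarrow> 'k::topological_space) \<Rightarrow> bool" where
  "stationary T P X \<longleftrightarrow> stoch_process T P X \<and> (\<forall>h\<in>T. same_fdd T P (\<lambda>t. X (t + h)) P X)"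

definition indep_processes ::
  "real set \<Rightarrow> 'w measure \<Rightarrow> (real \<Rightarrow> 'w \<Rightarrow> 'k::topological_space) \<Rightarrow> (real \<Rightarrow> 'w \<Rightarrow> 'k) \<Rightarrow> bool" where
  "indep_processes T P X Y \<longleftrightarrow>
     prob_space.indep_var P
       (PiM T (\<lambda>_. borel)) (\<lambda>\<omega>. \<lambda>t\<in>T. X t \<omega>)
       (PiM T (\<lambda>_. borel)) (\<lambda>\<omega>. \<lambda>t\<in>T. Y t \<omega>)"


definition kernel_Lalpha ::
  "real set \<Rightarrow> real \<Rightarrow> 's measure \<Rightarrow> (real \<Rightarrow> 's \<Rightarrow> 'k::{banach, second_countable_topology}) \<Rightarrow> bool" where
  "kernel_Lalpha T \<alpha> \<nu> f \<longleftrightarrow>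
     (\<lambda>(t, s). f t s) \<in> borel_measurable (time_measure T \<Otimes>\<^sub>M \<nu>) \<and> (\<forall>t\<in>T. in_Lalpha \<alpha> \<nu> (f t))"

text \<open>
  Equality in distribution of \<open>X\<close> with the symmetric \<open>\<alpha>\<close>-stable process given by integrating \<open>f t\<close>
  against a symmetric \<open>\<alpha>\<close>-stable random measure (rotationally invariant in the complex case)
  with control measure \<open>\<nu>\<close>. The law of that process is given by its joint characteristic
  functions, so the random measure itself does not appear.
\<close>

definition stable_integral_real ::
  "real set \<Rightarrow> real \<Rightarrow> 'w measure \<Rightarrow> (real \<Rightarrow> 'w \<Rightarrow> real) \<Rightarrow> 's measure \<Rightarrow> (real \<Rightarrow> 's \<Rightarrow> real) \<Rightarrow> bool" where
  "stable_integral_real T \<alpha> P X \<nu> f \<longleftrightarrow>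
     stoch_process T P X \<and> kernel_Lalpha T \<alpha> \<nu> f \<and>
     (\<forall>J \<theta>. finite J \<and> J \<subseteq> T \<longrightarrow>
        (\<integral>\<omega>. exp (\<i> * complex_of_real (\<Sum>t\<in>J. \<theta> t * X t \<omega>)) \<partial>P) =
        complex_of_real (exp (- (\<integral>s. \<bar>\<Sum>t\<in>J. \<theta> t * f t s\<bar> powr \<alpha> \<partial>\<nu>))))"

definition isotropic_const :: "real \<Rightarrow> real" where
  "isotropic_const \<alpha> = (1 / (2 * pi)) * (LINT \<phi>:{0..2 * pi}|lborel. \<bar>cos \<phi>\<bar> powr \<alpha>)"

definition stable_integral_complex ::
  "real set \<Rightarrow> real \<Rightarrow> 'w measure \<Rightarrow> (real \<Rightarrow> 'w \<Rightarrow> complex) \<Rightarrow> 's measure \<Rightarrow> (real \<Rightarrow> 's \<Rightarrow> complex) \<Rightarrow> bool" where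
  "stable_integral_complex T \<alpha> P X \<nu> f \<longleftrightarrow>
     stoch_process T P X \<and> kernel_Lalpha T \<alpha> \<nu> f \<and>
     (\<forall>J \<theta>. finite J \<and> J \<subseteq> T \<longrightarrow>
        (\<integral>\<omega>. exp (\<i> * complex_of_real (\<Sum>t\<in>J. Re (cnj (\<theta> t) * X t \<omega>))) \<partial>P) =
        complex_of_real (exp (- isotropic_const \<alpha> *
          (\<integral>s. cmod (\<Sum>t\<in>J. cnj (\<theta> t) * f t s) powr \<alpha> \<partial>\<nu>))))"


definition measurable_flow :: "real set \<Rightarrow> 's measure \<Rightarrow> (real \<Rightarrow> 's \<Rightarrow> 's) \<Rightarrow> bool" where
  "measurable_flow T \<nu> \<phi> \<longleftrightarrow>
     (\<lambda>(t, s). \<phi> t s) \<in> measurable (time_measure T \<Otimes>\<^sub>M \<nu>) \<nu> \<and>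
     (\<forall>s\<in>space \<nu>. \<phi> 0 s = s) \<and>
     (\<forall>t1\<in>T. \<forall>t2\<in>T. \<forall>s\<in>space \<nu>. \<phi> (t1 + t2) s = \<phi> t1 (\<phi> t2 s))"

definition nonsingular_flow :: "real set \<Rightarrow> 's measure \<Rightarrow> (real \<Rightarrow> 's \<Rightarrow> 's) \<Rightarrow> bool" where
  "nonsingular_flow T \<nu> \<phi> \<longleftrightarrow>
     (\<forall>t\<in>T. \<forall>N\<in>sets \<nu>. emeasure \<nu> N = 0 \<longleftrightarrow> emeasure \<nu> (\<phi> t -` N \<inter> space \<nu>) = 0)"

definition periodic_flow :: "real set \<Rightarrow> 's measure \<Rightarrow> (real \<Rightarrow> 's \<Rightarrow> 's) \<Rightarrow> bool" where
  "periodic_flow T \<nu> \<phi> \<longleftrightarrow> measurable_flow T \<nu> \<phi> \<and> (AE s in \<nu>. \<exists>p\<in>T - {0}. \<phi> p s = s)"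

definition cocycle ::
  "real set \<Rightarrow> 's measure \<Rightarrow> (real \<Rightarrow> 's \<Rightarrow> 's) \<Rightarrow> 'k::{topological_space, times} set \<Rightarrow> (real \<Rightarrow> 's \<Rightarrow> 'k) \<Rightarrow> bool" where
  "cocycle T \<nu> \<phi> A a \<longleftrightarrow>
     (\<lambda>(t, s). a t s) \<in> borel_measurable (time_measure T \<Otimes>\<^sub>M \<nu>) \<and>
     (\<forall>t\<in>T. \<forall>s\<in>space \<nu>. a t s \<in> A) \<and>
     (\<forall>t1\<in>T. \<forall>t2\<in>T. \<forall>s\<in>space \<nu>. a (t1 + t2) s = a t1 s * a t2 (\<phi> t1 s))"

text \<open>
  Since \<open>\<phi> t\<close> is invertible with inverse \<open>\<phi> (- t)\<close>, the measure \<open>\<nu> \<circ> \<phi>\<^sub>t\<close>, sending \<open>A\<close> to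
  \<open>\<nu> (\<phi> t ` A)\<close>, is the image of \<open>\<nu>\<close> under \<open>\<phi> (- t)\<close>.
\<close>

definition flow_density :: "'s measure \<Rightarrow> (real \<Rightarrow> 's \<Rightarrow> 's) \<Rightarrow> real \<Rightarrow> 's \<Rightarrow> real" where
  "flow_density \<nu> \<phi> t s = enn2real (RN_deriv \<nu> (distr \<nu> \<nu> (\<phi> (- t))) s)"

definition is_support :: "real set \<Rightarrow> 's measure \<Rightarrow> (real \<Rightarrow> 's \<Rightarrow> 'k::zero) \<Rightarrow> 's set \<Rightarrow> bool" where
  "is_support T \<nu> f A \<longleftrightarrow>
     A \<in> sets \<nu> \<and> (\<forall>t\<in>T. AE s in \<nu>. s \<notin> A \<longrightarrow> f t s = 0) \<and>
     (\<forall>B\<in>sets \<nu>. (\<forall>t\<in>T. AE s in \<nu>. s \<notin> B \<longrightarrow> f t s = 0) \<longrightarrow> (AE s in \<nu>. s \<in> A \<longrightarrow> s \<in> B))"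

definition flow_kernel ::
  "real set \<Rightarrow> real \<Rightarrow> 's measure \<Rightarrow> (real \<Rightarrow> 's \<Rightarrow> 's) \<Rightarrow> 'k::{real_normed_algebra_1} set \<Rightarrow> (real \<Rightarrow> 's \<Rightarrow> 'k) \<Rightarrow> bool" where
  "flow_kernel T \<alpha> \<nu> \<phi> A f \<longleftrightarrow>
     (\<exists>a. cocycle T \<nu> \<phi> A a \<and>
        (\<forall>t\<in>T. AE s in \<nu>. f t s = a t s * of_real (flow_density \<nu> \<phi> t s powr (1 / \<alpha>)) * f 0 (\<phi> t s))) \<and>
     is_support T \<nu> f (space \<nu>)"

definition generated_by_flow_real ::
  "real set \<Rightarrow> real \<Rightarrow> 'w measure \<Rightarrow> (real \<Rightarrow> 'w \<Rightarrow> real) \<Rightarrow> 's measure \<Rightarrow> (real \<Rightarrow> 's \<Rightarrow> 's) \<Rightarrow> bool" where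
  "generated_by_flow_real T \<alpha> P X \<nu> \<phi> \<longleftrightarrow>
     stationary T P X \<and> standard_lebesgue \<nu> \<and> measurable_flow T \<nu> \<phi> \<and> nonsingular_flow T \<nu> \<phi> \<and>
     (\<exists>f. stable_integral_real T \<alpha> P X \<nu> f \<and> flow_kernel T \<alpha> \<nu> \<phi> {-1, 1} f)"

definition generated_by_flow_complex ::
  "real set \<Rightarrow> real \<Rightarrow> 'w measure \<Rightarrow> (real \<Rightarrow> 'w \<Rightarrow> complex) \<Rightarrow> 's measure \<Rightarrow> (real \<Rightarrow> 's \<Rightarrow> 's) \<Rightarrow> bool" where
  "generated_by_flow_complex T \<alpha> P X \<nu> \<phi> \<longleftrightarrow>
     stationary T P X \<and> standard_lebesgue \<nu> \<and> measurable_flow T \<nu> \<phi> \<and> nonsingular_flow T \<nu> \<phi> \<and>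
     (\<exists>f. stable_integral_complex T \<alpha> P X \<nu> f \<and> flow_kernel T \<alpha> \<nu> \<phi> {w. cmod w = 1} f)"


text \<open>The space \<open>Z \<times> [0, q(\<cdot>))\<close> with the measure \<open>\<sigma>(dz) \<lambda>(dv)\<close>.\<close>

definition strip_measure :: "real set \<Rightarrow> 'z measure \<Rightarrow> ('z \<Rightarrow> real) \<Rightarrow> ('z \<times> real) measure" where
  "strip_measure T \<sigma> q = restrict_space (\<sigma> \<Otimes>\<^sub>M time_measure T) {(z, v). 0 \<le> v \<and> v < q z}"

definition cyclic_data ::
  "real set \<Rightarrow> real \<Rightarrow> 'k::{banach, second_countable_topology} set \<Rightarrow> 'z measure \<Rightarrow> ('z \<Rightarrow> real) \<Rightarrow>
   ('z \<Rightarrow> 'k) \<Rightarrow> ('z \<times> real \<Rightarrow> 'k) \<Rightarrow> bool" where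
  "cyclic_data T \<alpha> A \<sigma> q b g \<longleftrightarrow>
     standard_lebesgue \<sigma> \<and>
     q \<in> borel_measurable \<sigma> \<and> (AE z in \<sigma>. q z \<in> period_range T) \<and>
     b \<in> borel_measurable \<sigma> \<and> (\<forall>z\<in>space \<sigma>. b z \<in> A) \<and>
     in_Lalpha \<alpha> (strip_measure T \<sigma> q) g"

definition cyclic_kernel ::
  "('z \<Rightarrow> real) \<Rightarrow> ('z \<Rightarrow> 'k) \<Rightarrow> ('z \<times> real \<Rightarrow> 'k) \<Rightarrow> real \<Rightarrow> 'z \<times> real \<Rightarrow> 'k::field" where
  "cyclic_kernel q b g t = (\<lambda>(z, v). b z powi int_quot (q z) (v + t) * g (z, real_rem (q z) (v + t)))"

definition spectral_kernel_real :: "real set \<Rightarrow> real \<Rightarrow> nat \<Rightarrow> real" where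
  "spectral_kernel_real T t k = indicator {1} k + alternating T t * indicator {2} k"

definition spectral_kernel_complex :: "real \<Rightarrow> real \<Rightarrow> complex" where
  "spectral_kernel_complex t x = exp (\<i> * complex_of_real (t * x))"

end

theory Submission
  imports Defs
begin

text \<open>
  The first summand can be taken to be zero (\<open>\<eta> = 0\<close>): a fixed point of the flow is in particular
  a periodic point, and any \<open>q \<ge> 2\<close> in \<open>T\<close> serves as its period in the second summand.

  No cross-section of the flow is needed: the whole space \<open>S\<close>, placed in the real line by an
  injective Borel code, serves as \<open>Z\<close>, so that every orbit is represented many times. Let
  \<open>q s \<in> T\<close> be a measurable choice of a period of \<open>s\<close>, and push the measure \<open>\<kappa>(ds) \<lambda>(dv)\<close> on
  \<open>S \<times> [0, q(\<cdot>))\<close> forward under \<open>(s, v) \<mapsto> \<phi> v s\<close>, where \<open>\<kappa>\<close> is equivalent to \<open>\<nu>\<close>. The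
  result \<open>\<mu>\<close> is invariant under the flow and equivalent to \<open>\<nu>\<close>. With \<open>r = d\<nu>/d\<mu>\<close>, the
  density of \<open>\<nu> \<circ> \<phi> t\<close> is \<open>r (\<phi> t s) / r s\<close>, so that \<open>h t s = (r s) powr (1 / \<alpha>) * f t s\<close> equals
  \<open>a t s * h 0 (\<phi> t s)\<close>, which is \<open>q s\<close>-periodic in \<open>t\<close> up to the factor \<open>a (q s) s\<close>.
  Hence \<open>g (s, v) = h v s\<close> and \<open>b s = a (q s) s\<close> give the required kernel: linear combinations of
  the \<open>f t\<close> in \<open>L\<^sup>\<alpha>(\<nu>)\<close> have the same norm as those of the \<open>h t\<close> in \<open>L\<^sup>\<alpha>(\<mu>)\<close>, and the norm in
  \<open>L\<^sup>\<alpha>(\<mu>)\<close> is by construction an integral over \<open>S \<times> [0, q(\<cdot>))\<close>.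
\<close>

section \<open>Time\<close>

text \<open>\<open>time_measure\<close> is chosen by the test \<open>T = \<int>\<close>; for
  continuous time this fact refutes the test.\<close>

lemma Ints_neq_UNIV: "(\<int> :: real set) \<noteq> UNIV"
proof
  assume "(\<int> :: real set) = UNIV"
  then have "(1 / 2 :: real) \<in> \<int>" by simp
  then obtain n :: int where "(1 / 2 :: real) = of_int n" by (elim Ints_cases)
  then have "(of_int (2 * n) :: real) = of_int 1" by simp
  then have "2 * n = 1" unfolding of_int_eq_iff .
  then show False by presburger
qed

locale time_set =
  fixes T :: "real set"
  assumes time_cases: "T = \<int> \<or> T = UNIV"
begin

lemma time_closed [simp, intro]:
  "0 \<in> T" "1 \<in> T" "numeral k \<in> T" "s \<in> T \<Longrightarrow> t \<in> T \<Longrightarrow> s + t \<in> T" "t \<in> T \<Longrightarrow> - t \<in> T"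
  "s \<in> T \<Longrightarrow> t \<in> T \<Longrightarrow> s - t \<in> T" "s \<in> T \<Longrightarrow> t \<in> T \<Longrightarrow> s * t \<in> T" "of_int n \<in> T" "\<bar>t\<bar> \<in> T \<longleftrightarrow> t \<in> T"
  using time_cases by (auto simp: abs_if)

lemma space_time_measure [simp]: "space (time_measure T) = T"
  using time_cases by (auto simp: time_measure_def)

text \<open>In discrete time all subsets are measurable, but \<int> is countable, so preimages of
  single points suffice, and points are Borel.\<close>

lemma measurable_time_measureI:
  assumes "f \<in> borel_measurable M" and "\<And>x. x \<in> space M \<Longrightarrow> f x \<in> T"
  shows "f \<in> measurable M (time_measure T)"
proof (cases "T = \<int>")
  case True
  have "countable (\<int> :: real set)" by (simp add: Ints_def)
  then have "f \<in> measurable M (count_space \<int>)"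
    using assms True by (subst measurable_count_space_eq_countable) (auto intro: measurable_sets)
  then show ?thesis using True by (simp add: time_measure_def)
next
  case False
  then show ?thesis using assms by (simp add: time_measure_def)
qed

lemma measurable_time_borel [measurable]: "(\<lambda>t. t) \<in> borel_measurable (time_measure T)"
  by (auto simp: time_measure_def)

lemma measurable_from_time: "f \<in> borel_measurable borel \<Longrightarrow> f \<in> borel_measurable (time_measure T)"
  using measurable_compose[OF measurable_time_borel] by blast

lemma sigma_finite_time_measure: "sigma_finite_measure (time_measure T)"
proof -
  have "countable (\<int> :: real set)" by (simp add: Ints_def)
  then show ?thesis
    by (auto simp: time_measure_def sigma_finite_lborel sigma_finite_measure_count_space_countable)
qed

lemma nn_integral_time_shift:
  assumes [measurable]: "g \<in> borel_measurable (time_measure T)" and h: "h \<in> T"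
  shows "(\<integral>\<^sup>+v. g (v + h) \<partial>time_measure T) = (\<integral>\<^sup>+v. g v \<partial>time_measure T)"
proof (cases "T = \<int>")
  case True
  have "bij_betw (\<lambda>v. v + h) \<int> (\<int> :: real set)"
    by (rule bij_betwI[where g = "\<lambda>v. v - h"]) (use h True in auto)
  then show ?thesis
    using True nn_integral_bij_count_space[of "\<lambda>v. v + h" \<int> \<int> g] by (simp add: time_measure_def)
next
  case False
  then have "g \<in> borel_measurable borel" using assms(1) by (simp add: time_measure_def)
  then have "(\<integral>\<^sup>+v. g v \<partial>lborel) = ennreal \<bar>1\<bar> * (\<integral>\<^sup>+v. g (h + 1 * v) \<partial>lborel)"
    by (rule nn_integral_real_affine) simp
  then show ?thesis using False by (simp add: time_measure_def add.commute)
qed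

text \<open>Only the remainder \<open>r\<close> of \<open>h\<close> modulo \<open>q\<close> matters.
  The window [r, q + r) is cut at q, and the overhang [q, q + r) is moved back by one period to fill
  [0, r). This is the source of the invariance of \<open>orbit_measure\<close>.\<close>

lemma nn_integral_period_shift:
  assumes g [measurable]: "g \<in> borel_measurable (time_measure T)"
    and q: "q \<in> T" "0 < q" and per: "\<And>v. v \<in> T \<Longrightarrow> g (v + q) = g v" and h: "h \<in> T"
  shows "(\<integral>\<^sup>+v. indicator {0..<q} v * g (v + h) \<partial>time_measure T) =
         (\<integral>\<^sup>+v. indicator {0..<q} v * g v \<partial>time_measure T)"
proof -
  define n where "n = \<lfloor>h / q\<rfloor>"
  define r where "r = h - of_int n * q"
  have r: "r \<in> T" "0 \<le> r" "r < q"
    using q h floor_divide_lower[OF q(2), of h] floor_divide_upper[OF q(2), of h]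
    unfolding r_def n_def by (auto simp: algebra_simps)
  have nat_per: "g (v + of_nat k * q) = g v" if "v \<in> T" for v k
  proof (induction k)
    case (Suc k)
    have "of_nat k * q \<in> T" using time_closed(7)[OF time_closed(8)[of "int k"] q(1)] by simp
    then have "g ((v + of_nat k * q) + q) = g (v + of_nat k * q)" using that by (intro per) auto
    then show ?case using Suc by (simp add: algebra_simps)
  qed simp
  have int_per: "g (v + of_int k * q) = g v" if v: "v \<in> T" for v k
  proof (cases "0 \<le> k")
    case True
    then show ?thesis using nat_per[OF v, of "nat k"] by simp
  next
    case False
    have "v + of_int k * q \<in> T" using v q by auto
    from nat_per[OF this, of "nat (- k)"] show ?thesis using False by simp
  qed
  have "(\<integral>\<^sup>+v. indicator {0..<q} v * g (v + h) \<partial>time_measure T) =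
        (\<integral>\<^sup>+v. indicator {r..<q + r} (v + r) * g (v + r) \<partial>time_measure T)"
  proof (rule nn_integral_cong)
    fix v assume "v \<in> space (time_measure T)"
    then have "g (v + h) = g (v + r)"
      using int_per[of "v + r" n] r(1) by (simp add: r_def)
    then show "indicator {0..<q} v * g (v + h) = indicator {r..<q + r} (v + r) * g (v + r)"
      by (auto simp: indicator_def)
  qed
  also have "\<dots> = (\<integral>\<^sup>+v. indicator {r..<q + r} v * g v \<partial>time_measure T)"
    by (rule nn_integral_time_shift[of "\<lambda>v. indicator {r..<q + r} v * g v"])
       (use r in \<open>auto intro!: measurable_from_time borel_measurable_times g\<close>)
  also have "\<dots> = (\<integral>\<^sup>+v. indicator {r..<q} v * g v + indicator {q..<q + r} v * g v \<partial>time_measure T)"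
    using r by (intro nn_integral_cong) (auto simp: indicator_def)
  also have "\<dots> = (\<integral>\<^sup>+v. indicator {r..<q} v * g v \<partial>time_measure T) +
                  (\<integral>\<^sup>+v. indicator {q..<q + r} v * g v \<partial>time_measure T)"
    by (rule nn_integral_add) (auto intro!: measurable_from_time borel_measurable_times g)
  also have "(\<integral>\<^sup>+v. indicator {q..<q + r} v * g v \<partial>time_measure T) =
             (\<integral>\<^sup>+v. indicator {q..<q + r} (v + q) * g (v + q) \<partial>time_measure T)"
    by (rule nn_integral_time_shift[of "\<lambda>v. indicator {q..<q + r} v * g v", symmetric])
       (use q in \<open>auto intro!: measurable_from_time borel_measurable_times g\<close>)
  also have "\<dots> = (\<integral>\<^sup>+v. indicator {0..<r} v * g v \<partial>time_measure T)"
    using per by (intro nn_integral_cong) (auto simp: indicator_def)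
  also have "(\<integral>\<^sup>+v. indicator {r..<q} v * g v \<partial>time_measure T) + \<dots> =
    (\<integral>\<^sup>+v. indicator {r..<q} v * g v + indicator {0..<r} v * g v \<partial>time_measure T)"
    by (rule nn_integral_add[symmetric]) (auto intro!: measurable_from_time borel_measurable_times g)
  also have "\<dots> = (\<integral>\<^sup>+v. indicator {0..<q} v * g v \<partial>time_measure T)"
    using r by (intro nn_integral_cong) (auto simp: indicator_def)
  finally show ?thesis .
qed

end

section \<open>Borel codes in the real line\<close>

text \<open>The base-3 expansion of the indicators of \<open>U n\<close>: the digits can be read off, so every
  \<open>U n\<close> is a Borel preimage under it.\<close>

definition ternary_code :: "(nat \<Rightarrow> 'a set) \<Rightarrow> nat \<Rightarrow> 'a \<Rightarrow> real" where
  "ternary_code U n s = (\<Sum>i. indicator (U (n + i)) s * (1 / 3) ^ Suc i)"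

primrec ternary_shift :: "nat \<Rightarrow> real \<Rightarrow> real" where
  "ternary_shift 0 x = x"
| "ternary_shift (Suc n) x = 3 * ternary_shift n x - (if ternary_shift n x \<ge> 1 / 3 then 1 else 0)"

lemma measurable_ternary_shift [measurable]: "ternary_shift n \<in> borel_measurable borel"
  by (induction n) (simp_all del: ternary_shift.simps add: ternary_shift.simps[abs_def])

lemma summable_ternary: "summable (\<lambda>i. indicator (V i) s * (1 / 3) ^ Suc i :: real)"
  by (rule summable_comparison_test'[where g = "\<lambda>i. (1 / 3 :: real) ^ i" and N = 0])
     (auto simp: indicator_def summable_geometric)

lemma ternary_code_bounds: "0 \<le> ternary_code U n s" "ternary_code U n s \<le> 1 / 2"
proof -
  show "0 \<le> ternary_code U n s"
    unfolding ternary_code_def by (intro suminf_nonneg summable_ternary) auto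
  have g: "(\<lambda>i. (1 / 3 :: real) ^ Suc i) sums (1 / 2)"
    using sums_mult[OF geometric_sums[of "1 / 3 :: real"], of "1 / 3"] by simp
  have "ternary_code U n s \<le> (\<Sum>i. (1 / 3 :: real) ^ Suc i)"
    unfolding ternary_code_def using g
    by (intro suminf_le summable_ternary) (auto simp: indicator_def sums_iff)
  then show "ternary_code U n s \<le> 1 / 2" using g by (simp add: sums_iff)
qed

lemma ternary_code_step:
  "3 * ternary_code U n s = indicator (U n) s + ternary_code U (Suc n) s"
proof -
  have "ternary_code U n s = (\<Sum>i. indicator (U (n + Suc i)) s * (1 / 3) ^ Suc (Suc i)) + indicator (U n) s / 3"
    unfolding ternary_code_def
    by (subst suminf_split_head[OF summable_ternary, of "\<lambda>i. U (n + i)" s, symmetric, THEN sym]) simp_all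
  also have "(\<Sum>i. indicator (U (n + Suc i)) s * (1 / 3) ^ Suc (Suc i)) = ternary_code U (Suc n) s / 3"
    unfolding ternary_code_def
    by (subst suminf_divide[OF summable_ternary, symmetric]) simp
  finally show ?thesis by simp
qed

text \<open>A leading digit 0 leaves at most 1 / 6, a leading digit 1 gives at least 1 / 3. In base
  2 this gap would close up.\<close>

lemma ternary_code_ge_iff: "ternary_code U n s \<ge> 1 / 3 \<longleftrightarrow> s \<in> U n"
  using ternary_code_step[of U n s] ternary_code_bounds[of U "Suc n" s] ternary_code_bounds[of U n s]
  by (cases "s \<in> U n") simp_all

lemma ternary_shift_code: "ternary_shift n (ternary_code U 0 s) = ternary_code U n s"
proof (induction n)
  case (Suc n)
  then show ?case
    using ternary_code_step[of U n s] ternary_code_ge_iff[of U n s] by (cases "s \<in> U n") simp_all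
qed simp

text \<open>The digits of the code are membership in the sets of a countable base. Basic sets are
  then Borel preimages, open sets are countable unions of these, and preimages of Borel sets form a
  sigma-algebra. The Hausdorff property gives injectivity. The last conclusion stands in for a Borel
  isomorphism onto the image.\<close>

lemma standard_borel_code:
  assumes "standard_borel M"
  obtains c :: "'a \<Rightarrow> real" where
    "c \<in> borel_measurable M" "\<And>s. 0 \<le> c s" "\<And>s. c s \<le> 1" "inj_on c (space M)"
    "\<And>A. A \<in> sets M \<Longrightarrow> \<exists>B\<in>sets borel. A = c -` B \<inter> space M"
proof -
  obtain X where X: "completely_metrizable_space X" "second_countable X" "topspace X = space M"
    and sets: "sets M = sigma_sets (topspace X) {U. openin X U}"
    using assms unfolding standard_borel_def by (elim exE conjE)
  obtain \<B> where B: "countable \<B>" "\<And>V. V \<in> \<B> \<Longrightarrow> openin X V"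
    "\<And>U x. openin X U \<Longrightarrow> x \<in> U \<Longrightarrow> \<exists>V\<in>\<B>. x \<in> V \<and> V \<subseteq> U"
    using X(2) unfolding second_countable_def by (elim exE conjE) blast
  \<comment> \<open>The empty set is added so that the family enumerated is never empty.\<close>
  define U where "U = from_nat_into (insert {} \<B>)"
  have U: "range U = insert {} \<B>"
    unfolding U_def using B(1) by (intro range_from_nat_into) auto
  have U_open: "openin X (U n)" for n
  proof -
    have "U n \<in> insert {} \<B>" using U by blast
    then show ?thesis using B(2) by auto
  qed
  have U_sets [measurable]: "U n \<in> sets M" for n
    unfolding sets using U_open by blast
  define c where "c = ternary_code U 0"
  have c_meas [measurable]: "c \<in> borel_measurable M"
    unfolding c_def ternary_code_def by measurable
  have U_code: "U n = c -` {x. ternary_shift n x \<ge> 1 / 3} \<inter> space M" for n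
    using sets.sets_into_space[OF U_sets[of n]]
    unfolding c_def vimage_def mem_Collect_eq ternary_shift_code ternary_code_ge_iff by blast
  have basis: "\<exists>B\<in>sets borel. V = c -` B \<inter> space M" if "V \<in> \<B>" for V
  proof -
    have "V \<in> range U" using U that by simp
    then obtain n where "V = U n" by blast
    moreover have "{x. ternary_shift n x \<ge> 1 / 3} \<in> sets borel" by measurable
    ultimately show ?thesis using U_code by blast
  qed
  have opens: "\<exists>B\<in>sets borel. V = c -` B \<inter> space M" if V: "openin X V" for V
  proof -
    let ?C = "{W \<in> \<B>. W \<subseteq> V}"
    have "V = \<Union>?C" using B(3)[OF V] by blast
    moreover obtain D where D: "\<And>W. W \<in> ?C \<Longrightarrow> D W \<in> sets borel \<and> W = c -` D W \<inter> space M"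
      using basis by (metis (mono_tags, lifting) mem_Collect_eq)
    ultimately have "V = c -` (\<Union>W\<in>?C. D W) \<inter> space M" by blast
    moreover have "(\<Union>W\<in>?C. D W) \<in> sets borel"
      using B(1) D by (intro sets.countable_UN'') auto
    ultimately show ?thesis by blast
  qed
  show thesis
  proof
    show "c \<in> borel_measurable M" by fact
    show "0 \<le> c s" "c s \<le> 1" for s
      using ternary_code_bounds[of U 0 s] by (auto simp: c_def)
    show "inj_on c (space M)"
    proof (rule inj_onI, rule ccontr)
      fix x y assume xy: "x \<in> space M" "y \<in> space M" "c x = c y" "x \<noteq> y"
      have "Hausdorff_space X"
        using X(1) completely_metrizable_imp_metrizable_space metrizable_imp_Hausdorff_space by blast
      moreover have "x \<in> topspace X \<and> y \<in> topspace X \<and> x \<noteq> y" using xy X(3) by simp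
      ultimately obtain V W where VW: "openin X V" "x \<in> V" "y \<in> W" "disjnt V W"
        unfolding Hausdorff_space_def by meson
      obtain D where "V = c -` D \<inter> space M" using opens[OF VW(1)] by blast
      then have "y \<in> V" using VW(2) xy by simp
      then show False using VW(3,4) by (simp add: disjnt_iff)
    qed
    show "\<exists>B\<in>sets borel. A = c -` B \<inter> space M" if "A \<in> sets M" for A
      using that unfolding sets
    proof (induction rule: sigma_sets.induct)
      case (Basic a)
      then show ?case using opens by blast
    next
      case Empty
      show ?case by (rule bexI[of _ "{}"]) auto
    next
      case (Compl a)
      then obtain B where "B \<in> sets borel" "a = c -` B \<inter> space M" by blast
      then show ?case using X(3) by (intro bexI[of _ "- B"]) auto
    next
      case (Union a)
      then obtain D where "\<And>i. D i \<in> sets borel \<and> a i = c -` D i \<inter> space M" by metis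
      then show ?case by (intro bexI[of _ "\<Union>i. D i"]) auto
    qed
  qed
qed

section \<open>Factoring measurable functions through a code\<close>

lemma doob_dynkin_real:
  fixes h :: "'a \<Rightarrow> real"
  assumes h [measurable]: "h \<in> borel_measurable M"
    and pre: "\<And>A. A \<in> sets M \<Longrightarrow> \<exists>B\<in>sets N. A = C -` B \<inter> space M"
  obtains H where "H \<in> borel_measurable N" "\<And>x. x \<in> space M \<Longrightarrow> h x = H (C x)"
proof -
  have "\<exists>B\<in>sets N. {x \<in> space M. h x \<ge> r} = C -` B \<inter> space M" for r
    by (intro pre) measurable
  then obtain B where B [measurable]: "\<And>r. B r \<in> sets N"
    and B_eq: "\<And>r. {x \<in> space M. h x \<ge> r} = C -` B r \<inter> space M" by metis
  \<comment> \<open>A function is recovered from its superlevel sets: \<open>h x\<close> is the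
    supremum of the rationals below it. Off the range of \<open>C\<close> the sets
    \<open>B r\<close> may be unrelated and the supremum infinite; \<open>ereal\<close> and
    \<open>real_of_ereal\<close> still give a measurable function there.\<close>
  define H where "H y = real_of_ereal (SUP r\<in>\<rat>. if y \<in> B r then ereal r else - \<infinity>)" for y
  have rat: "countable (\<rat> :: real set)" by (rule countable_rat)
  have "H \<in> borel_measurable N"
    unfolding H_def using rat by measurable
  moreover have "h x = H (C x)" if x: "x \<in> space M" for x
  proof -
    have mem: "C x \<in> B r \<longleftrightarrow> r \<le> h x" for r using B_eq[of r] x by blast
    have "(SUP r\<in>\<rat>. if r \<le> h x then ereal r else - \<infinity>) = ereal (h x)"
    proof (rule SUP_eqI)
      fix y assume y: "\<And>r. r \<in> \<rat> \<Longrightarrow> (if r \<le> h x then ereal r else - \<infinity>) \<le> y"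
      show "ereal (h x) \<le> y"
      proof (rule ccontr)
        assume "\<not> ereal (h x) \<le> y"
        then have "y < ereal (h x)" by simp
        then obtain z where z: "y < ereal z" "z < h x"
          using ereal_dense2[OF \<open>y < ereal (h x)\<close>] by auto
        obtain r where r: "r \<in> \<rat>" "z < r" "r < h x" using Rats_dense_in_real[OF z(2)] by blast
        then have "ereal r \<le> y" using y[of r] by simp
        then show False using z(1) r(2)
          by (meson ereal_less_eq(3) less_imp_le not_less order_trans)
      qed
    qed auto
    then show ?thesis by (simp add: H_def mem)
  qed
  ultimately show thesis using that by blast
qed

lemma doob_dynkin:
  fixes h :: "'a \<Rightarrow> 'k::euclidean_space"
  assumes h [measurable]: "h \<in> borel_measurable M"
    and pre: "\<And>A. A \<in> sets M \<Longrightarrow> \<exists>B\<in>sets N. A = C -` B \<inter> space M"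
  obtains H where "H \<in> borel_measurable N" "\<And>x. x \<in> space M \<Longrightarrow> h x = H (C x)"
proof -
  have "\<exists>H. H \<in> borel_measurable N \<and> (\<forall>x\<in>space M. h x \<bullet> b = H (C x))" for b
    by (rule doob_dynkin_real[of "\<lambda>x. h x \<bullet> b", OF _ pre]) auto
  then obtain H where H [measurable]: "\<And>b. H b \<in> borel_measurable N"
    and H_eq: "\<And>b x. x \<in> space M \<Longrightarrow> h x \<bullet> b = H b (C x)" by metis
  show thesis
  proof
    show "(\<lambda>y. \<Sum>b\<in>Basis. H b y *\<^sub>R b) \<in> borel_measurable N" by measurable
    show "h x = (\<Sum>b\<in>Basis. H b (C x) *\<^sub>R b)" if "x \<in> space M" for x
      using euclidean_representation[of "h x"] H_eq[OF that] by simp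
  qed
qed

text \<open>The identity, from the sigma-algebra pulled back along (s, v) \<mapsto> (c s, v) to the
  product, is measurable because both of its coordinates are; so each product set already lies in
  the pullback. This lets \<open>doob_dynkin\<close> treat functions of s and v jointly.\<close>

lemma vimage_sets_pair:
  assumes c: "c \<in> space M \<rightarrow> space K"
    and pre: "\<And>A. A \<in> sets M \<Longrightarrow> \<exists>B\<in>sets K. A = c -` B \<inter> space M"
    and A: "A \<in> sets (M \<Otimes>\<^sub>M L)"
  shows "\<exists>B\<in>sets (K \<Otimes>\<^sub>M L). A = (\<lambda>(s, v). (c s, v)) -` B \<inter> space (M \<Otimes>\<^sub>M L)"
proof -
  let ?f = "\<lambda>(s, v). (c s, v)" and ?S = "space M \<times> space L"
  let ?V = "vimage_algebra ?S ?f (K \<Otimes>\<^sub>M L)"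
  have f: "?f \<in> ?S \<rightarrow> space (K \<Otimes>\<^sub>M L)"
    using c by (auto simp: space_pair_measure)
  have [measurable]: "?f \<in> measurable ?V (K \<Otimes>\<^sub>M L)"
    by (rule measurable_vimage_algebra1[OF f])
  have "(\<lambda>x. x) \<in> measurable ?V (M \<Otimes>\<^sub>M L)"
  proof (rule measurable_pair)
    show "fst \<circ> (\<lambda>x. x) \<in> measurable ?V M"
    proof (rule measurableI)
      fix A assume "A \<in> sets M"
      then obtain B where B: "B \<in> sets K" "A = c -` B \<inter> space M" using pre by blast
      have "(fst \<circ> (\<lambda>x. x)) -` A \<inter> space ?V = ?f -` (fst -` B \<inter> space (K \<Otimes>\<^sub>M L)) \<inter> ?S"
        using f B(2) by (auto simp: Pi_iff)
      also have "\<dots> \<in> sets ?V"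
        using B(1) by (intro in_vimage_algebra measurable_sets[OF measurable_fst])
      finally show "(fst \<circ> (\<lambda>x. x)) -` A \<inter> space ?V \<in> sets ?V" .
    qed auto
    have "(\<lambda>x. snd (?f x)) \<in> measurable ?V L" by measurable
    then show "snd \<circ> (\<lambda>x. x) \<in> measurable ?V L" by (simp add: comp_def case_prod_beta)
  qed
  from measurable_sets[OF this A] have "A \<in> sets ?V"
    using sets.sets_into_space[OF A] by (simp add: space_pair_measure Int_absorb2)
  then show ?thesis
    using f by (auto simp: sets_vimage_algebra2 space_pair_measure)
qed

section \<open>Measurable choice of a period\<close>

lemma integral_Icc_unit_bounded:
  fixes u :: "real \<Rightarrow> real"
  assumes [measurable]: "u \<in> borel_measurable borel" and u: "\<And>t. 0 \<le> u t" "\<And>t. u t \<le> 1"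
  shows "integrable lborel (\<lambda>t. indicator {a..b} t * u t)"
    and "a \<le> b \<Longrightarrow> a' \<le> b' \<Longrightarrow>
      \<bar>(\<integral>t. indicator {a..b} t * u t \<partial>lborel) - (\<integral>t. indicator {a'..b'} t * u t \<partial>lborel)\<bar>
        \<le> \<bar>a - a'\<bar> + \<bar>b - b'\<bar>"
proof -
  have ind: "integrable lborel (\<lambda>t. indicator {a..b} t :: real)" for a b :: real
    by (cases "a \<le> b") auto
  have int: "integrable lborel (\<lambda>t. indicator {a..b} t * u t)" for a b
    by (rule Bochner_Integration.integrable_bound[OF ind[of a b]])
       (use u in \<open>auto simp: indicator_def\<close>)
  then show "integrable lborel (\<lambda>t. indicator {a..b} t * u t)" .
  assume ab: "a \<le> b" "a' \<le> b'"
  \<comment> \<open>The two windows differ only between corresponding end points, and u is at most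
    1, so \<open>?J\<close> dominates the difference of the integrands.\<close>
  let ?J = "\<lambda>t. indicator {min a a'..max a a'} t + indicator {min b b'..max b b'} t :: real"
  have "\<bar>(\<integral>t. indicator {a..b} t * u t \<partial>lborel) - (\<integral>t. indicator {a'..b'} t * u t \<partial>lborel)\<bar>
      = \<bar>\<integral>t. indicator {a..b} t * u t - indicator {a'..b'} t * u t \<partial>lborel\<bar>"
    using int by simp
  also have "\<dots> \<le> (\<integral>t. ?J t \<partial>lborel)"
  proof -
    have "norm (\<integral>t. indicator {a..b} t * u t - indicator {a'..b'} t * u t \<partial>lborel) \<le> (\<integral>t. ?J t \<partial>lborel)"
    proof (rule Bochner_Integration.integral_norm_bound_integral)
      show "norm (indicator {a..b} t * u t - indicator {a'..b'} t * u t) \<le> ?J t" for t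
        using u[of t] ab by (auto simp: indicator_def)
    qed (use int ind in auto)
    then show ?thesis unfolding real_norm_def .
  qed
  also have "\<dots> = (max a a' - min a a') + (max b b' - min b b')"
    by (subst Bochner_Integration.integral_add[OF ind ind]) simp
  finally show "\<bar>(\<integral>t. indicator {a..b} t * u t \<partial>lborel) - (\<integral>t. indicator {a'..b'} t * u t \<partial>lborel)\<bar>
        \<le> \<bar>a - a'\<bar> + \<bar>b - b'\<bar>" by linarith
qed

text \<open>Equal integrals over all [0, x] give the measures with densities u and v on [0, 1] the
  same tails, so these measures coincide and u = v almost everywhere on [0, 1]. A single point of
  agreement is all that is extracted: along an orbit, coincidence at one time spreads to all
  times.\<close>

lemma equal_somewhere_if_integrals_equal:
  fixes u v :: "real \<Rightarrow> real"
  assumes [measurable]: "u \<in> borel_measurable borel" "v \<in> borel_measurable borel"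
    and u: "\<And>t. 0 \<le> u t" "\<And>t. u t \<le> 1" and v: "\<And>t. 0 \<le> v t" "\<And>t. v t \<le> 1"
    and eq: "\<And>x. 0 \<le> x \<Longrightarrow> x \<le> 1 \<Longrightarrow>
      (\<integral>t. indicator {0..x} t * u t \<partial>lborel) = (\<integral>t. indicator {0..x} t * v t \<partial>lborel)"
  shows "\<exists>t. u t = v t"
proof -
  note intu = integral_Icc_unit_bounded(1)[OF assms(1) u]
  note intv = integral_Icc_unit_bounded(1)[OF assms(2) v]
  have tail: "emeasure (density lborel (\<lambda>t. ennreal (indicator {0..1} t * w t))) {x<..} =
      ennreal ((\<integral>t. indicator {0..1} t * w t \<partial>lborel)
        - (if x < 0 then 0 else \<integral>t. indicator {0..min x 1} t * w t \<partial>lborel))"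
    if [measurable]: "w \<in> borel_measurable borel" and w: "\<And>t. 0 \<le> w t" "\<And>t. w t \<le> 1" for x :: real and w :: "real \<Rightarrow> real"
  proof -
    note int = integral_Icc_unit_bounded(1)[OF that]
    \<comment> \<open>The tail beyond x is written as a difference of initial segments, the only
      windows whose integrals are known to agree; for negative x nothing is cut off.\<close>
    let ?f = "\<lambda>t. indicator {0..1} t * w t - (if x < 0 then 0 else indicator {0..min x 1} t * w t)"
    have "emeasure (density lborel (\<lambda>t. ennreal (indicator {0..1} t * w t))) {x<..} =
        (\<integral>\<^sup>+t. ennreal (?f t) \<partial>lborel)"
      by (subst emeasure_density) (auto intro!: nn_integral_cong simp: indicator_def)
    also have "\<dots> = ennreal (\<integral>t. ?f t \<partial>lborel)"
    proof (rule nn_integral_eq_integral)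
      show "integrable lborel ?f" using int by (cases "x < 0") auto
      show "AE t in lborel. 0 \<le> ?f t" using w by (auto simp: indicator_def)
    qed
    also have "(\<integral>t. ?f t \<partial>lborel) = (\<integral>t. indicator {0..1} t * w t \<partial>lborel)
        - (if x < 0 then 0 else \<integral>t. indicator {0..min x 1} t * w t \<partial>lborel)"
      using int by (cases "x < 0") simp_all
    finally show ?thesis .
  qed
  let ?M = "\<lambda>w. density lborel (\<lambda>t. ennreal (indicator {0..1} t * w t))"
  have "?M u = ?M v"
  proof (rule measure_eqI_lessThan)
    show "emeasure (?M u) {x<..} < \<infinity>" for x
      by (subst tail) (use u in auto)
    show "emeasure (?M u) {x<..} = emeasure (?M v) {x<..}" for x
      using eq[of 1] eq[of "min x 1"] tail[OF assms(1) u] tail[OF assms(2) v] by simp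
  qed auto
  moreover have "(\<integral>\<^sup>+t. ennreal (indicator {0..1} t * u t) \<partial>lborel) \<noteq> \<infinity>"
    using intu[of 0 1] u by (subst nn_integral_eq_integral) auto
  ultimately have "AE t in lborel. ennreal (indicator {0..1} t * u t) = ennreal (indicator {0..1} t * v t)"
    by (subst (asm) finite_density_unique) auto
  \<comment> \<open>The unit interval has positive length, so agreement almost everywhere on it is
    not vacuous.\<close>
  moreover have "\<not> (AE t in lborel. t \<notin> {0..1 :: real})"
  proof
    assume "AE t in lborel. t \<notin> {0..1 :: real}"
    then have "emeasure lborel {t. \<not> t \<notin> {0..1 :: real}} = 0"
      by (subst (asm) AE_iff_measurable[OF _ refl]) auto
    then have "emeasure lborel {0..1 :: real} = 0" by (simp only: not_not Collect_mem_eq)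
    then show False by simp
  qed
  moreover have "t \<notin> {0..1}" if "ennreal (indicator {0..1} t * u t) = ennreal (indicator {0..1} t * v t)"
    and "u t \<noteq> v t" for t
    using that u[of t] v[of t] by (auto simp: indicator_def)
  ultimately show ?thesis
    by (metis (mono_tags, lifting) AE_mp AE_I2)
qed

section \<open>Flows on a standard Borel space and their periods\<close>

locale flow_space = time_set +
  fixes \<nu> :: "'s measure" and \<phi> :: "real \<Rightarrow> 's \<Rightarrow> 's"
  assumes standard_borel: "standard_borel \<nu>"
    and flow: "measurable_flow T \<nu> \<phi>"
begin

lemma flow_measurable_pair [measurable]:
  "(\<lambda>(t, s). \<phi> t s) \<in> measurable (time_measure T \<Otimes>\<^sub>M \<nu>) \<nu>"
  using flow by (simp add: measurable_flow_def)

lemma flow_zero [simp]: "s \<in> space \<nu> \<Longrightarrow> \<phi> 0 s = s"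
  using flow by (simp add: measurable_flow_def)

lemma flow_add: "t1 \<in> T \<Longrightarrow> t2 \<in> T \<Longrightarrow> s \<in> space \<nu> \<Longrightarrow> \<phi> (t1 + t2) s = \<phi> t1 (\<phi> t2 s)"
  using flow by (simp add: measurable_flow_def)

lemma flow_measurable [measurable (raw)]:
  assumes "f \<in> measurable N (time_measure T)" and "g \<in> measurable N \<nu>"
  shows "(\<lambda>x. \<phi> (f x) (g x)) \<in> measurable N \<nu>"
  using measurable_compose[OF measurable_Pair[OF assms] flow_measurable_pair] by simp

lemma flow_measurable_at [measurable]: "t \<in> T \<Longrightarrow> \<phi> t \<in> measurable \<nu> \<nu>"
  by (rule flow_measurable[of "\<lambda>_. t" \<nu> "\<lambda>s. s"]) auto

lemma flow_space [simp]: "t \<in> T \<Longrightarrow> s \<in> space \<nu> \<Longrightarrow> \<phi> t s \<in> space \<nu>"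
  using measurable_space[OF flow_measurable_at] .

lemma flow_cancel: "t \<in> T \<Longrightarrow> s \<in> space \<nu> \<Longrightarrow> \<phi> (- t) (\<phi> t s) = s"
  using flow_add[of "- t" t s] by simp

text \<open>The map \<open>\<phi> t\<close> is invertible, so it can be cancelled: coincidence with
  the shifted orbit at one time t is the same as coincidence at time 0.\<close>

lemma period_shift:
  assumes "p \<in> T" "t \<in> T" "s \<in> space \<nu>"
  shows "\<phi> (t + p) s = \<phi> t s \<longleftrightarrow> \<phi> p s = s"
  using assms flow_add[of t p s] flow_cancel[of t "\<phi> p s"] flow_cancel[of t s] by auto

lemma period_multiple:
  assumes p: "p \<in> T" "s \<in> space \<nu>" "\<phi> p s = s"
  shows "\<phi> (of_int n * p) s = s"
proof -
  have nat: "of_nat k * p \<in> T \<and> \<phi> (of_nat k * p) s = s" for k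
  proof (induction k)
    case (Suc k)
    then show ?case
      using p flow_add[of "of_nat k * p" p s] by (auto simp: algebra_simps)
  qed (use p in auto)
  show ?thesis
  proof (cases "0 \<le> n")
    case True
    then show ?thesis using nat[of "nat n"] by simp
  next
    case False
    then show ?thesis
      using nat[of "nat (- n)"] flow_cancel[of "of_nat (nat (- n)) * p" s] p by simp
  qed
qed

text \<open>Not the fundamental period is sought, only some period of at least 2. The bound keeps
  the infimum positive even at fixed points of the flow, where every p is a period, and places all
  values in \<open>period_range T\<close> for both kinds of time.\<close>

definition periods :: "'s \<Rightarrow> real set" where
  "periods s = {p \<in> T. 2 \<le> p \<and> \<phi> p s = s}"

text \<open>The injective code turns equality of points into equality of two real measurable
  functions.\<close>

lemma fixed_set_measurable: "p \<in> T \<Longrightarrow> {s \<in> space \<nu>. \<phi> p s = s} \<in> sets \<nu>"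
proof -
  assume p: "p \<in> T"
  obtain c :: "'s \<Rightarrow> real" where [measurable]: "c \<in> borel_measurable \<nu>" and c: "inj_on c (space \<nu>)"
    using standard_borel_code[OF standard_borel] by metis
  have "{s \<in> space \<nu>. \<phi> p s = s} = {s \<in> space \<nu>. c (\<phi> p s) = c s}"
    using c p by (auto dest: inj_onD)
  also have "\<dots> \<in> sets \<nu>" using p by measurable
  finally show ?thesis .
qed

text \<open>Along an orbit the code is bounded and Borel, so its integrals over moving intervals depend
  continuously on the shift. They detect periods, although the flow itself need not be continuous.\<close>

lemma real_period_test:
  assumes T: "T = UNIV"
  obtains W :: "real \<Rightarrow> real \<Rightarrow> 's \<Rightarrow> real" where
    "\<And>x p. W x p \<in> borel_measurable \<nu>"
    "\<And>x p p' s. 0 \<le> x \<Longrightarrow> s \<in> space \<nu> \<Longrightarrow> \<bar>W x p s - W x p' s\<bar> \<le> 2 * \<bar>p - p'\<bar>"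
    "\<And>p s. s \<in> space \<nu> \<Longrightarrow> \<phi> p s = s \<longleftrightarrow> (\<forall>x\<in>\<rat> \<inter> {0..1}. W x p s = 0)"
proof -
  obtain c :: "'s \<Rightarrow> real" where c [measurable]: "c \<in> borel_measurable \<nu>"
    and c01: "\<And>s. 0 \<le> c s" "\<And>s. c s \<le> 1" and c_inj: "inj_on c (space \<nu>)"
    using standard_borel_code[OF standard_borel] by metis
  have [measurable]: "(\<lambda>(t, s). \<phi> t s) \<in> measurable (lborel \<Otimes>\<^sub>M \<nu>) \<nu>"
    using flow_measurable_pair Ints_neq_UNIV T by (simp add: time_measure_def)
  have [measurable]: "(\<lambda>(t, s). \<phi> t s) \<in> measurable (borel \<Otimes>\<^sub>M \<nu>) \<nu>"
    using flow_measurable_pair Ints_neq_UNIV T by (simp add: time_measure_def cong: measurable_cong_sets)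
  have orb [measurable]: "(\<lambda>t. c (\<phi> (t + p) s)) \<in> borel_measurable borel" if "s \<in> space \<nu>" for p s
    using that by measurable
  \<comment> \<open>The code averaged over a window of length x that starts at time p of the orbit.
    The test \<open>W x p\<close> will be the difference between the windows starting at p and at
    0.\<close>
  define G where "G x p s = (\<integral>t. indicator {0..x} t * c (\<phi> (t + p) s) \<partial>lborel)" for x p s
  have G_meas [measurable]: "G x p \<in> borel_measurable \<nu>" for x p
    unfolding G_def by measurable
  have G_shift: "G x p s = (\<integral>t. indicator {p..x + p} t * c (\<phi> t s) \<partial>lborel)" for x p s
  proof -
    have "(\<integral>t. indicator {p..x + p} t * c (\<phi> t s) \<partial>lborel) =
        \<bar>1\<bar> *\<^sub>R (\<integral>t. indicator {p..x + p} (p + 1 * t) * c (\<phi> (p + 1 * t) s) \<partial>lborel)"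
      by (rule lborel_integral_real_affine) simp
    also have "\<dots> = G x p s"
      unfolding G_def by (auto intro!: Bochner_Integration.integral_cong simp: indicator_def add.commute)
    finally show ?thesis by simp
  qed
  have G_lip: "\<bar>G x p s - G x p' s\<bar> \<le> 2 * \<bar>p - p'\<bar>" if "0 \<le> x" "s \<in> space \<nu>" for x p p' s
    unfolding G_shift
    using integral_Icc_unit_bounded(2)[of "\<lambda>t. c (\<phi> t s)" p "x + p" p' "x + p'"]
      orb[of s 0] c01 that by simp
  have G_cont: "\<bar>G x p s - G y p s\<bar> \<le> \<bar>x - y\<bar>" if "0 \<le> x" "0 \<le> y" "s \<in> space \<nu>" for x y p s
    unfolding G_def
    using integral_Icc_unit_bounded(2)[of "\<lambda>t. c (\<phi> (t + p) s)" 0 x 0 y] orb[of s p] c01 that by simp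
  show thesis
  proof
    show "(\<lambda>s. G x p s - G x 0 s) \<in> borel_measurable \<nu>" for x p by measurable
    show "\<bar>(G x p s - G x 0 s) - (G x p' s - G x 0 s)\<bar> \<le> 2 * \<bar>p - p'\<bar>"
      if "0 \<le> x" "s \<in> space \<nu>" for x p p' s
      using G_lip[OF that] by simp
    show "\<phi> p s = s \<longleftrightarrow> (\<forall>x\<in>\<rat> \<inter> {0..1}. G x p s - G x 0 s = 0)" if s: "s \<in> space \<nu>" for p s
    proof
      assume "\<phi> p s = s"
      then have "\<phi> (t + p) s = \<phi> t s" for t
        using period_shift[of p t s] T s by simp
      then show "\<forall>x\<in>\<rat> \<inter> {0..1}. G x p s - G x 0 s = 0" by (simp add: G_def)
    next
      assume rat: "\<forall>x\<in>\<rat> \<inter> {0..1}. G x p s - G x 0 s = 0"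
      \<comment> \<open>Continuity in the window length passes from rational x to all x in
        [0, 1].\<close>
      have all: "G x p s = G x 0 s" if x: "0 \<le> x" "x \<le> 1" for x
      proof (rule ccontr)
        assume ne: "G x p s \<noteq> G x 0 s"
        define e where "e = \<bar>G x p s - G x 0 s\<bar> / 2"
        have e: "0 < e" using ne by (simp add: e_def)
        obtain y where y: "y \<in> \<rat>" "0 \<le> y" "y \<le> 1" "\<bar>x - y\<bar> < e"
        proof (cases "x = 0")
          case True
          then show thesis using that[of 0] e by simp
        next
          case False
          have "max 0 (x - e) < x" using x False e by simp
          then obtain y where "y \<in> \<rat>" "max 0 (x - e) < y" "y < x"
            using Rats_dense_in_real by blast
          then show thesis using that[of y] x by simp
        qed
        have "G y p s = G y 0 s" using rat y by simp
        then have "\<bar>G x p s - G x 0 s\<bar> \<le> \<bar>G x p s - G y p s\<bar> + \<bar>G x 0 s - G y 0 s\<bar>" by simp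
        also have "\<dots> \<le> \<bar>x - y\<bar> + \<bar>x - y\<bar>"
          by (intro add_mono G_cont x y s)
        also have "\<dots> < \<bar>G x p s - G x 0 s\<bar>" using y(4) by (simp add: e_def)
        finally show False by simp
      qed
      \<comment> \<open>Equality of all window integrals yields one time with equal codes;
        injectivity of the code and \<open>period_shift\<close> then give the period.\<close>
      have "\<exists>t. c (\<phi> (t + p) s) = c (\<phi> t s)"
      proof (rule equal_somewhere_if_integrals_equal)
        show "(\<lambda>t. c (\<phi> (t + p) s)) \<in> borel_measurable borel" "(\<lambda>t. c (\<phi> t s)) \<in> borel_measurable borel"
          using orb[OF s, of p] orb[OF s, of 0] by simp_all
      qed (use c01 all in \<open>simp_all add: G_def\<close>)
      then obtain t where "c (\<phi> (t + p) s) = c (\<phi> t s)" by blast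
      then have "\<phi> (t + p) s = \<phi> t s" using c_inj s T by (auto dest: inj_onD)
      then show "\<phi> p s = s" using period_shift[of p t s] T s by simp
    qed
  qed
qed

text \<open>Closedness makes the infimum of \<open>periods s\<close> a period itself. In real time
  the periods form a common zero set of functions \<open>W x\<close> that are Lipschitz in p; in
  integer time every subset is closed.\<close>

lemma closed_periods:
  assumes s: "s \<in> space \<nu>"
  shows "closed (periods s)"
proof (cases "T = \<int>")
  case True
  show ?thesis by (intro closed_subset_Ints) (use True periods_def in blast)
next
  case False
  then have T: "T = UNIV" using time_cases by simp
  obtain W :: "real \<Rightarrow> real \<Rightarrow> 's \<Rightarrow> real" where
    lip: "\<And>x p p' s. 0 \<le> x \<Longrightarrow> s \<in> space \<nu> \<Longrightarrow> \<bar>W x p s - W x p' s\<bar> \<le> 2 * \<bar>p - p'\<bar>" and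
    W: "\<And>p s. s \<in> space \<nu> \<Longrightarrow> \<phi> p s = s \<longleftrightarrow> (\<forall>x\<in>\<rat> \<inter> {0..1}. W x p s = 0)"
    using real_period_test[OF T] by metis
  have cont: "continuous_on UNIV (\<lambda>p. W x p s)" if "0 \<le> x" for x
  proof -
    have "2-lipschitz_on UNIV (\<lambda>p. W x p s)"
      using lip[OF that s] by (intro lipschitz_onI) (auto simp: dist_real_def)
    then show ?thesis by (rule lipschitz_on_continuous_on)
  qed
  have "periods s = {2..} \<inter> (\<Inter>x\<in>\<rat> \<inter> {0..1}. {p. W x p s = 0})"
    unfolding periods_def using W[OF s] T by auto
  also have "closed \<dots>"
    using cont by (intro closed_Int closed_INT ballI closed_Collect_eq) auto
  finally show ?thesis .
qed

text \<open>In integer time this is a countable union of fixed-point sets. In real time the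
  uncountable quantifier over p is replaced by a countable one: for every n some rational p passes
  all tests up to an error of order 1 / (n + 1). Such approximate periods stay in [1, r + 1], and by
  compactness and the Lipschitz bound a limit point is an exact period.\<close>

lemma periods_le_measurable: "{s \<in> space \<nu>. \<exists>p\<in>periods s. p \<le> r} \<in> sets \<nu>"
proof (cases "T = \<int>")
  case True
  have "{s \<in> space \<nu>. \<exists>p\<in>periods s. p \<le> r} = (\<Union>p\<in>{p\<in>\<int>. 2 \<le> p \<and> p \<le> r}. {s \<in> space \<nu>. \<phi> p s = s})"
    unfolding periods_def using True by auto
  also have "\<dots> \<in> sets \<nu>"
  proof (rule sets.countable_UN'')
    have "countable (\<int> :: real set)" by (simp add: Ints_def)
    then show "countable {p :: real \<in> \<int>. 2 \<le> p \<and> p \<le> r}" by (rule countable_subset[rotated]) auto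
  qed (use True fixed_set_measurable in auto)
  finally show ?thesis .
next
  case False
  then have T: "T = UNIV" using time_cases by simp
  obtain W :: "real \<Rightarrow> real \<Rightarrow> 's \<Rightarrow> real" where
    W_meas [measurable]: "\<And>x p. W x p \<in> borel_measurable \<nu>" and
    lip: "\<And>x p p' s. 0 \<le> x \<Longrightarrow> s \<in> space \<nu> \<Longrightarrow> \<bar>W x p s - W x p' s\<bar> \<le> 2 * \<bar>p - p'\<bar>" and
    W: "\<And>p s. s \<in> space \<nu> \<Longrightarrow> \<phi> p s = s \<longleftrightarrow> (\<forall>x\<in>\<rat> \<inter> {0..1}. W x p s = 0)"
    using real_period_test[OF T] by metis
  \<comment> \<open>The tolerance 2 / (n + 1) comes from the Lipschitz constant 2 and a rational
    within 1 / (n + 1) of a true period.\<close>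
  let ?near = "\<lambda>s n p. 2 - 1 / real (Suc n) \<le> p \<and> p \<le> r + 1 / real (Suc n) \<and>
    (\<forall>x\<in>\<rat> \<inter> {0..1}. \<bar>W x p s\<bar> \<le> 2 / real (Suc n))"
  have "(\<exists>p\<in>periods s. p \<le> r) \<longleftrightarrow> (\<forall>n. \<exists>p\<in>\<rat>. ?near s n p)" if s: "s \<in> space \<nu>" for s
  proof
    assume "\<exists>p\<in>periods s. p \<le> r"
    then obtain p where p: "2 \<le> p" "p \<le> r" "\<phi> p s = s" by (auto simp: periods_def)
    show "\<forall>n. \<exists>p\<in>\<rat>. ?near s n p"
    proof
      fix n
      have "p < p + 1 / real (Suc n)" by simp
      then obtain p' where p': "p' \<in> \<rat>" "p < p'" "p' < p + 1 / real (Suc n)"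
        using Rats_dense_in_real by blast
      have "\<bar>W x p' s\<bar> \<le> 2 / real (Suc n)" if "x \<in> \<rat> \<inter> {0..1}" for x
        using lip[of x s p' p] W[OF s, of p] p p' s that by (auto simp: abs_if split: if_splits)
      then show "\<exists>p\<in>\<rat>. ?near s n p" using p p' by (intro bexI[of _ p']) auto
    qed
  next
    assume "\<forall>n. \<exists>p\<in>\<rat>. ?near s n p"
    then obtain P where P: "\<And>n. ?near s n (P n)" by metis
    have "P n \<in> {1..r + 1}" for n
    proof -
      have "1 / real (Suc n) \<le> 1" by simp
      then show ?thesis using P[of n] unfolding atLeastAtMost_iff by linarith
    qed
    moreover have "compact {1..r + 1}" by simp
    ultimately obtain p k where pk: "strict_mono (k :: nat \<Rightarrow> nat)" "(P \<circ> k) \<longlonglongrightarrow> p"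
      unfolding compact_def by metis
    have inv: "(\<lambda>n. a + b / real (Suc (k n))) \<longlonglongrightarrow> a" for a b
    proof -
      have "(\<lambda>n. b * inverse (real (Suc n))) \<longlonglongrightarrow> b * 0"
        by (intro tendsto_mult tendsto_const LIMSEQ_inverse_real_of_nat)
      then have "(\<lambda>n. a + b * inverse (real (Suc n))) \<longlonglongrightarrow> a + b * 0"
        by (intro tendsto_add tendsto_const)
      from LIMSEQ_subseq_LIMSEQ[OF this pk(1)] show ?thesis
        by (simp add: comp_def divide_inverse)
    qed
    have "2 \<le> p"
      using LIMSEQ_le[OF inv[of 2 "-1"] pk(2)] P by auto
    moreover have "p \<le> r"
      using LIMSEQ_le[OF pk(2) inv[of r 1]] P by auto
    moreover have "W x p s = 0" if x: "x \<in> \<rat> \<inter> {0..1}" for x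
    proof -
      have "\<bar>W x p s\<bar> \<le> 0 + 2 / real (Suc (k n)) + 2 * \<bar>(P \<circ> k) n - p\<bar>" for n
      proof -
        have "\<bar>W x p s - W x (P (k n)) s\<bar> \<le> 2 * \<bar>p - P (k n)\<bar>" using lip[of x s] x s by simp
        moreover have "\<bar>W x (P (k n)) s\<bar> \<le> 2 / real (Suc (k n))" using P[of "k n"] x by blast
        moreover have "\<bar>W x p s\<bar> \<le> \<bar>W x p s - W x (P (k n)) s\<bar> + \<bar>W x (P (k n)) s\<bar>" by simp
        ultimately show ?thesis by (simp add: abs_minus_commute)
      qed
      moreover have "(\<lambda>n. 0 + 2 / real (Suc (k n)) + 2 * \<bar>(P \<circ> k) n - p\<bar>) \<longlonglongrightarrow> 0 + 2 * \<bar>p - p\<bar>"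
        by (intro tendsto_add[OF inv] tendsto_intros pk(2))
      ultimately have "\<bar>W x p s\<bar> \<le> 0 + 2 * \<bar>p - p\<bar>"
        by (intro LIMSEQ_le_const) auto
      then show ?thesis by simp
    qed
    ultimately show "\<exists>p\<in>periods s. p \<le> r"
      unfolding periods_def using W[OF s] T by auto
  qed
  then have "{s \<in> space \<nu>. \<exists>p\<in>periods s. p \<le> r} = {s \<in> space \<nu>. \<forall>n. \<exists>p\<in>\<rat>. ?near s n p}"
    by blast
  also have "\<dots> \<in> sets \<nu>"
  proof (intro sets.sets_Collect_countable_All sets.sets_Collect_countable_Ex' sets.sets_Collect_conj
      sets.sets_Collect_countable_All' sets.sets_Collect_const countable_rat)
    show "countable (\<rat> \<inter> {0..1 :: real})" using countable_rat by (rule countable_subset[rotated]) auto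
    show "{s \<in> space \<nu>. \<bar>W x p s\<bar> \<le> 2 / real (Suc n)} \<in> sets \<nu>" for x p n by measurable
  qed
  finally show ?thesis .
qed

text \<open>The default 2 keeps \<open>period s\<close> in \<open>T\<close> and at least 2 also at
  points of the space that have no period.\<close>

definition period :: "'s \<Rightarrow> real" where
  "period s = (if periods s = {} then 2 else Inf (periods s))"

lemma period_in_periods: "s \<in> space \<nu> \<Longrightarrow> periods s \<noteq> {} \<Longrightarrow> period s \<in> periods s"
  using closed_contains_Inf[OF _ bdd_belowI[of _ 2] closed_periods[of s]]
  by (simp add: period_def) (simp add: periods_def)

lemma period_ge_2: "s \<in> space \<nu> \<Longrightarrow> 2 \<le> period s"
  using period_in_periods[of s] by (cases "periods s = {}") (auto simp: period_def periods_def)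

lemma period_in_time: "s \<in> space \<nu> \<Longrightarrow> period s \<in> T"
  using period_in_periods[of s] by (cases "periods s = {}") (auto simp: period_def periods_def)

lemma period_measurable [measurable]: "period \<in> borel_measurable \<nu>"
proof (rule borel_measurableI_le)
  fix r
  let ?E = "\<lambda>r. {s \<in> space \<nu>. \<exists>p\<in>periods s. p \<le> r}"
  have [measurable]: "?E r \<in> sets \<nu>" for r by (rule periods_le_measurable)
  \<comment> \<open>Points outside all \<open>?E (real n)\<close> are exactly those without a
    period, where the default value 2 decides.\<close>
  have "(period s \<le> r) = (s \<in> ?E r \<or> (2 \<le> r \<and> (\<forall>n. s \<notin> ?E (real n))))" if s: "s \<in> space \<nu>" for s
  proof (cases "periods s = {}")
    case True
    then show ?thesis using s by (auto simp: period_def)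
  next
    case False
    have "\<not> (\<forall>n. s \<notin> ?E (real n))"
      using False s real_arch_simple by blast
    moreover have "period s \<le> r \<longleftrightarrow> (\<exists>p\<in>periods s. p \<le> r)"
    proof
      assume "\<exists>p\<in>periods s. p \<le> r"
      then obtain p where p: "p \<in> periods s" "p \<le> r" by blast
      have "Inf (periods s) \<le> p"
        using p(1) by (intro cInf_lower bdd_belowI[of _ 2]) (auto simp: periods_def)
      then show "period s \<le> r" using p False by (simp add: period_def)
    qed (use period_in_periods[OF s False] in blast)
    ultimately show ?thesis using s by blast
  qed
  then have "{s \<in> space \<nu>. period s \<le> r} =
      {s \<in> space \<nu>. s \<in> ?E r \<or> (2 \<le> r \<and> (\<forall>n. s \<notin> ?E (real n)))}" by blast
  also have "\<dots> \<in> sets \<nu>" by measurable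
  finally show "{s \<in> space \<nu>. period s \<le> r} \<in> sets \<nu>" .
qed

lemma AE_period:
  assumes "AE s in \<nu>. \<exists>p\<in>T - {0}. \<phi> p s = s"
  shows "AE s in \<nu>. \<phi> (period s) s = s"
  using assms AE_space
proof eventually_elim
  case (elim s)
  then obtain p where p: "p \<in> T" "p \<noteq> 0" "\<phi> p s = s" by blast
  \<comment> \<open>The sign makes the multiple n p positive, and the ceiling lifts it to at least
    2.\<close>
  define n where "n = (if 0 < p then 1 else - 1) * \<lceil>2 / \<bar>p\<bar>\<rceil>"
  have "2 / \<bar>p\<bar> \<le> real_of_int \<lceil>2 / \<bar>p\<bar>\<rceil>" by (rule le_of_int_ceiling)
  then have "2 \<le> of_int \<lceil>2 / \<bar>p\<bar>\<rceil> * \<bar>p\<bar>" using p(2) by (subst (asm) pos_divide_le_eq) auto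
  also have "\<dots> = of_int n * p" using p(2) by (auto simp: n_def)
  finally have "of_int n * p \<in> periods s"
    using p elim period_multiple[of p s n] by (simp add: periods_def)
  then show ?case
    using period_in_periods[of s] elim by (auto simp: periods_def)
qed

end

section \<open>The measure averaged over orbits\<close>

text \<open>Cancellation of c, weakened to an inequality because the left-hand side is 0 when c is
  0.\<close>

lemma divide_times_le_ennreal:
  fixes a c :: ennreal
  assumes "c < \<infinity>"
  shows "a / c * c \<le> a"
proof (cases "c = 0")
  case False
  then have "a * c / c = a" using assms by (intro mult_divide_eq_ennreal) auto
  then show ?thesis by (simp add: mult.commute[of _ c] ennreal_times_divide)
qed simp

context time_set
begin

lemma strip_set_measurable:
  assumes [measurable]: "q \<in> borel_measurable \<sigma>"
  shows "{(z, v). 0 \<le> v \<and> v < q z} \<inter> space (\<sigma> \<Otimes>\<^sub>M time_measure T) \<in> sets (\<sigma> \<Otimes>\<^sub>M time_measure T)"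
proof -
  have [measurable]: "(\<lambda>x. snd x) \<in> borel_measurable (\<sigma> \<Otimes>\<^sub>M time_measure T)"
    by (rule measurable_compose[OF measurable_snd measurable_time_borel])
  have "{x \<in> space (\<sigma> \<Otimes>\<^sub>M time_measure T). 0 \<le> snd x \<and> snd x < q (fst x)} \<in> sets (\<sigma> \<Otimes>\<^sub>M time_measure T)"
    by measurable
  moreover have "{(z, v). 0 \<le> v \<and> v < q z} \<inter> space (\<sigma> \<Otimes>\<^sub>M time_measure T) =
      {x \<in> space (\<sigma> \<Otimes>\<^sub>M time_measure T). 0 \<le> snd x \<and> snd x < q (fst x)}" by auto
  ultimately show ?thesis by simp
qed

lemma nn_integral_strip:
  assumes "q \<in> borel_measurable \<sigma>" and [measurable]: "f \<in> borel_measurable (\<sigma> \<Otimes>\<^sub>M time_measure T)"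
  shows "(\<integral>\<^sup>+x. f x \<partial>strip_measure T \<sigma> q) =
    (\<integral>\<^sup>+z. \<integral>\<^sup>+v. indicator {0..<q z} v * f (z, v) \<partial>time_measure T \<partial>\<sigma>)"
proof -
  let ?S = "{(z, v). 0 \<le> v \<and> v < q z}"
  note S = strip_set_measurable[OF assms(1)]
  interpret L: sigma_finite_measure "time_measure T" by (rule sigma_finite_time_measure)
  have [measurable]: "(indicator ?S :: _ \<Rightarrow> ennreal) \<in> borel_measurable (\<sigma> \<Otimes>\<^sub>M time_measure T)"
    using S by (subst borel_measurable_indicator_iff) simp_all
  have "(\<integral>\<^sup>+x. f x \<partial>strip_measure T \<sigma> q) = (\<integral>\<^sup>+x. f x * indicator ?S x \<partial>(\<sigma> \<Otimes>\<^sub>M time_measure T))"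
    unfolding strip_measure_def using S by (intro nn_integral_restrict_space) simp
  also have "\<dots> = (\<integral>\<^sup>+z. \<integral>\<^sup>+v. f (z, v) * indicator ?S (z, v) \<partial>time_measure T \<partial>\<sigma>)"
    by (rule L.nn_integral_fst[symmetric]) measurable
  finally show ?thesis by (simp add: indicator_def mult.commute)
qed

lemma time_Ico_sets: "{a..<b} \<inter> T \<in> sets (time_measure T)"
proof -
  have "(\<lambda>t. t) -` {a..<b} \<inter> space (time_measure T) \<in> sets (time_measure T)"
    by (rule measurable_sets[OF measurable_time_borel]) simp
  then show ?thesis by simp
qed

lemma emeasure_time_Ico_finite: "emeasure (time_measure T) ({a..<b} \<inter> T) < \<infinity>"
proof (cases "T = \<int>")
  case True
  have "{a..<b} \<inter> \<int> \<subseteq> of_int ` {\<lfloor>a\<rfloor>..\<lceil>b\<rceil>}"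
  proof
    fix x :: real assume x: "x \<in> {a..<b} \<inter> \<int>"
    then obtain n where "x = of_int n" by (auto elim: Ints_cases)
    then show "x \<in> of_int ` {\<lfloor>a\<rfloor>..\<lceil>b\<rceil>}" using x by (auto simp: floor_le_iff le_ceiling_iff)
  qed
  then have "finite ({a..<b} \<inter> \<int>)" by (rule finite_subset) auto
  then show ?thesis using True by (simp add: time_measure_def of_nat_less_top)
next
  case False
  then have "T = UNIV" using time_cases by simp
  then show ?thesis using False by (cases "a \<le> b") (simp_all add: time_measure_def)
qed

lemma emeasure_time_Ico_unit: "emeasure (time_measure T) ({0..<1} \<inter> T) \<noteq> 0"
proof (cases "T = \<int>")
  case True
  have "0 \<in> {0..<1} \<inter> T" by simp
  then have "{0..<1} \<inter> T \<noteq> {}" by blast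
  then show ?thesis
    using True by (auto simp: time_measure_def emeasure_count_space)
next
  case False
  then have "T = UNIV" using time_cases by simp
  then show ?thesis using False by (simp add: time_measure_def)
qed

end

locale periodic_flow_space = flow_space T \<nu> \<phi>
  for T :: "real set" and \<nu> :: "'s measure" and \<phi> :: "real \<Rightarrow> 's \<Rightarrow> 's" +
  assumes sigma_finite_base: "sigma_finite_measure \<nu>"
    and nonsingular: "nonsingular_flow T \<nu> \<phi>"
    and periodic: "AE s in \<nu>. \<exists>p\<in>T - {0}. \<phi> p s = s"
begin

sublocale sigma_finite_measure \<nu> by (rule sigma_finite_base)

text \<open>A positive density of finite total mass exists by sigma-finiteness; it trades \<nu> for
  an equivalent finite measure.\<close>

definition weight :: "'s \<Rightarrow> ennreal" where
  "weight = (SOME h. h \<in> borel_measurable \<nu> \<and> integral\<^sup>N \<nu> h \<noteq> \<infinity> \<and> (\<forall>x\<in>space \<nu>. 0 < h x \<and> h x < \<infinity>))"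

lemma weight: "weight \<in> borel_measurable \<nu>" "integral\<^sup>N \<nu> weight \<noteq> \<infinity>"
  "s \<in> space \<nu> \<Longrightarrow> 0 < weight s" "s \<in> space \<nu> \<Longrightarrow> weight s < \<infinity>"
proof -
  have "\<exists>h. h \<in> borel_measurable \<nu> \<and> integral\<^sup>N \<nu> h \<noteq> \<infinity> \<and> (\<forall>x\<in>space \<nu>. 0 < h x \<and> h x < \<infinity>)"
    using Ex_finite_integrable_function by blast
  from someI_ex[OF this] show "weight \<in> borel_measurable \<nu>" "integral\<^sup>N \<nu> weight \<noteq> \<infinity>"
    "s \<in> space \<nu> \<Longrightarrow> 0 < weight s" "s \<in> space \<nu> \<Longrightarrow> weight s < \<infinity>"
    unfolding weight_def[symmetric] by blast+
qed

definition cycle_length :: "'s \<Rightarrow> ennreal" where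
  "cycle_length s = (\<integral>\<^sup>+v. indicator {0..<period s} v \<partial>time_measure T)"

lemma indicator_strip_measurable [measurable]:
  "(\<lambda>(s, v). indicator {0..<period s} v :: ennreal) \<in> borel_measurable (\<nu> \<Otimes>\<^sub>M time_measure T)"
proof -
  have "(\<lambda>(s, v). indicator {0..<period s} v :: ennreal) = indicator {(z, v). 0 \<le> v \<and> v < period z}"
    by (auto simp: indicator_def fun_eq_iff)
  then show ?thesis
    using strip_set_measurable[OF period_measurable] by (simp add: borel_measurable_indicator_iff)
qed

lemma cycle_length_measurable [measurable]: "cycle_length \<in> borel_measurable \<nu>"
proof -
  interpret L: sigma_finite_measure "time_measure T" by (rule sigma_finite_time_measure)
  show ?thesis unfolding cycle_length_def[abs_def]
    using L.borel_measurable_nn_integral[OF indicator_strip_measurable] by simp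
qed

lemma cycle_length_finite: "cycle_length s < \<infinity>"
proof -
  have "cycle_length s = (\<integral>\<^sup>+v. indicator ({0..<period s} \<inter> T) v \<partial>time_measure T)"
    unfolding cycle_length_def by (intro nn_integral_cong) (auto simp: indicator_def)
  also have "\<dots> = emeasure (time_measure T) ({0..<period s} \<inter> T)"
    by (rule nn_integral_indicator[OF time_Ico_sets])
  finally show ?thesis using emeasure_time_Ico_finite by simp
qed

lemma cycle_length_ge:
  assumes "s \<in> space \<nu>"
  shows "emeasure (time_measure T) ({0..<1} \<inter> T) \<le> cycle_length s"
proof -
  have "emeasure (time_measure T) ({0..<1} \<inter> T) = (\<integral>\<^sup>+v. indicator ({0..<1} \<inter> T) v \<partial>time_measure T)"
    by (rule nn_integral_indicator[symmetric]) (rule time_Ico_sets)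
  also have "\<dots> \<le> cycle_length s"
    unfolding cycle_length_def using period_ge_2[OF assms]
    by (intro nn_integral_mono) (auto simp: indicator_def)
  finally show ?thesis .
qed

text \<open>The measure \<kappa> of the overview. Dividing by the cycle length keeps the mass of the
  strip over it finite even if the periods are unbounded.\<close>

definition base_measure :: "'s measure" where
  "base_measure = density \<nu> (\<lambda>s. weight s / cycle_length s)"

lemma sets_base_measure [simp, measurable_cong]: "sets base_measure = sets \<nu>"
  by (simp add: base_measure_def)

lemma space_base_measure [simp]: "space base_measure = space \<nu>"
  by (simp add: base_measure_def)

lemma finite_base_measure: "finite_measure base_measure"
proof
  have [measurable]: "weight \<in> borel_measurable \<nu>" by (rule weight(1))
  \<comment> \<open>Every cycle contains the window [0, 1), whose mass \<open>?u\<close> is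
    positive; hence \<open>?u\<close> times the mass of \<open>base_measure\<close> is at most the
    integral of \<open>weight\<close>.\<close>
  let ?u = "emeasure (time_measure T) ({0..<1} \<inter> T)"
  have "?u * emeasure base_measure (space base_measure) = (\<integral>\<^sup>+s. ?u * 1 \<partial>base_measure)"
    by (subst nn_integral_cmult) auto
  also have "\<dots> = (\<integral>\<^sup>+s. weight s / cycle_length s * (?u * 1) \<partial>\<nu>)"
    unfolding base_measure_def by (intro nn_integral_density) measurable
  also have "\<dots> \<le> (\<integral>\<^sup>+s. weight s \<partial>\<nu>)"
  proof (rule nn_integral_mono)
    fix s assume "s \<in> space \<nu>"
    then have "weight s / cycle_length s * (?u * 1) \<le> weight s / cycle_length s * cycle_length s"
      using cycle_length_ge by (intro mult_left_mono) auto
    also have "\<dots> \<le> weight s" using cycle_length_finite by (rule divide_times_le_ennreal)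
    finally show "weight s / cycle_length s * (?u * 1) \<le> weight s" .
  qed
  finally show "emeasure base_measure (space base_measure) \<noteq> \<infinity>"
    using weight(2) emeasure_time_Ico_unit by (auto simp: top_unique ennreal_mult_top)
qed

lemma AE_base_measure: "(AE s in base_measure. Q s) \<longleftrightarrow> (AE s in \<nu>. Q s)"
proof -
  have "0 < weight s / cycle_length s" if "s \<in> space \<nu>" for s
    using weight(3)[OF that] cycle_length_finite[of s]
    by (simp add: zero_less_iff_neq_zero ennreal_divide_eq_0_iff)
  moreover have [measurable]: "weight \<in> borel_measurable \<nu>" by (rule weight(1))
  ultimately show ?thesis
    unfolding base_measure_def by (subst AE_density) (auto intro!: AE_cong)
qed

lemma null_sets_base_measure: "N \<in> sets \<nu> \<Longrightarrow> emeasure base_measure N = 0 \<longleftrightarrow> emeasure \<nu> N = 0"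
  using AE_base_measure[of "\<lambda>s. s \<notin> N"]
  by (simp add: AE_iff_null_sets[symmetric] null_sets_def)

lemma orbit_map_measurable [measurable]:
  "(\<lambda>(s, v). \<phi> v s) \<in> measurable (base_measure \<Otimes>\<^sub>M time_measure T) \<nu>"
  by measurable

text \<open>The measure \<mu> of the overview. An orbit is covered again and again, from each of its
  starting points; this is harmless, since invariance, finiteness and the null sets are what
  counts.\<close>

definition orbit_measure :: "'s measure" where
  "orbit_measure = distr (strip_measure T base_measure period) \<nu> (\<lambda>(s, v). \<phi> v s)"

lemma sets_orbit_measure [simp, measurable_cong]: "sets orbit_measure = sets \<nu>"
  by (simp add: orbit_measure_def)

lemma space_orbit_measure [simp]: "space orbit_measure = space \<nu>"
  by (simp add: orbit_measure_def)

lemma period_measurable_base [measurable]: "period \<in> borel_measurable base_measure"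
  using period_measurable by (simp cong: measurable_cong_sets)

lemma orbit_map_strip [measurable]:
  "(\<lambda>(s, v). \<phi> v s) \<in> measurable (strip_measure T base_measure period) \<nu>"
  unfolding strip_measure_def by (intro measurable_restrict_space1 orbit_map_measurable)

lemma nn_integral_orbit:
  assumes [measurable]: "f \<in> borel_measurable \<nu>"
  shows "(\<integral>\<^sup>+s. f s \<partial>orbit_measure) =
    (\<integral>\<^sup>+s. \<integral>\<^sup>+v. indicator {0..<period s} v * f (\<phi> v s) \<partial>time_measure T \<partial>base_measure)"
proof -
  have "(\<integral>\<^sup>+s. f s \<partial>orbit_measure) =
      (\<integral>\<^sup>+x. f ((\<lambda>(s, v). \<phi> v s) x) \<partial>strip_measure T base_measure period)"
    unfolding orbit_measure_def by (intro nn_integral_distr) measurable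
  also have "\<dots> = (\<integral>\<^sup>+s. \<integral>\<^sup>+v. indicator {0..<period s} v * f ((\<lambda>(s, v). \<phi> v s) (s, v)) \<partial>time_measure T \<partial>base_measure)"
    by (rule nn_integral_strip) measurable
  finally show ?thesis by simp
qed

lemma finite_orbit_measure: "finite_measure orbit_measure"
proof
  have [measurable]: "weight \<in> borel_measurable \<nu>" by (rule weight(1))
  have "emeasure orbit_measure (space orbit_measure) = (\<integral>\<^sup>+s. 1 \<partial>orbit_measure)" by simp
  also have "\<dots> = (\<integral>\<^sup>+s. cycle_length s \<partial>base_measure)"
    by (subst nn_integral_orbit) (simp_all add: cycle_length_def[abs_def])
  also have "\<dots> = (\<integral>\<^sup>+s. (weight s / cycle_length s) * cycle_length s \<partial>\<nu>)"
    unfolding base_measure_def by (intro nn_integral_density) measurable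
  also have "\<dots> \<le> (\<integral>\<^sup>+s. weight s \<partial>\<nu>)"
  proof (rule nn_integral_mono)
    fix s
    show "weight s / cycle_length s * cycle_length s \<le> weight s"
      using cycle_length_finite by (rule divide_times_le_ennreal)
  qed
  finally show "emeasure orbit_measure (space orbit_measure) \<noteq> \<infinity>"
    using weight(2) by (auto simp: top_unique)
qed

text \<open>For almost every start s the integrand along the orbit is periodic with
  \<open>period s\<close>, so shifting time by h does not change the integral over one
  cycle.\<close>

lemma nn_integral_orbit_invariant:
  assumes [measurable]: "f \<in> borel_measurable \<nu>" and h: "h \<in> T"
  shows "(\<integral>\<^sup>+s. f (\<phi> h s) \<partial>orbit_measure) = (\<integral>\<^sup>+s. f s \<partial>orbit_measure)"
proof -
  have "AE s in base_measure. \<phi> (period s) s = s"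
    using AE_period[OF periodic] by (simp add: AE_base_measure)
  then have "AE s in base_measure.
     (\<integral>\<^sup>+v. indicator {0..<period s} v * f (\<phi> h (\<phi> v s)) \<partial>time_measure T) =
     (\<integral>\<^sup>+v. indicator {0..<period s} v * f (\<phi> v s) \<partial>time_measure T)"
    using AE_space
  proof eventually_elim
    case (elim s)
    then have s: "s \<in> space \<nu>" by simp
    note q = period_in_time[OF s] period_ge_2[OF s]
    have "(\<integral>\<^sup>+v. indicator {0..<period s} v * f (\<phi> h (\<phi> v s)) \<partial>time_measure T) =
        (\<integral>\<^sup>+v. indicator {0..<period s} v * f (\<phi> (v + h) s) \<partial>time_measure T)"
      using s h by (intro nn_integral_cong) (simp add: flow_add[symmetric] add.commute)
    also have "\<dots> = (\<integral>\<^sup>+v. indicator {0..<period s} v * f (\<phi> v s) \<partial>time_measure T)"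
    proof (rule nn_integral_period_shift)
      show "(\<lambda>v. f (\<phi> v s)) \<in> borel_measurable (time_measure T)" using s by measurable
      show "f (\<phi> (v + period s) s) = f (\<phi> v s)" if "v \<in> T" for v
        using flow_add[OF that q(1) s] elim by simp
    qed (use q h in auto)
    finally show ?case .
  qed
  then show ?thesis
    using h by (subst (1 2) nn_integral_orbit) (auto intro: nn_integral_cong_AE)
qed

text \<open>With time on the outside, nonsingularity can be applied to each fixed v.\<close>

lemma emeasure_orbit_Fubini:
  assumes [measurable]: "A \<in> sets \<nu>"
  shows "emeasure orbit_measure A =
    (\<integral>\<^sup>+v. \<integral>\<^sup>+s. indicator {0..<period s} v * indicator A (\<phi> v s) \<partial>base_measure \<partial>time_measure T)"
proof -
  interpret L: sigma_finite_measure "time_measure T" by (rule sigma_finite_time_measure)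
  interpret B: finite_measure base_measure by (rule finite_base_measure)
  interpret pair_sigma_finite base_measure "time_measure T" ..
  have "emeasure orbit_measure A = (\<integral>\<^sup>+s. indicator A s \<partial>orbit_measure)" by simp
  also have "\<dots> = (\<integral>\<^sup>+s. \<integral>\<^sup>+v. indicator {0..<period s} v * indicator A (\<phi> v s) \<partial>time_measure T \<partial>base_measure)"
    by (rule nn_integral_orbit) measurable
  also have "\<dots> = (\<integral>\<^sup>+v. \<integral>\<^sup>+s. indicator {0..<period s} v * indicator A (\<phi> v s) \<partial>base_measure \<partial>time_measure T)"
    by (rule Fubini'[symmetric]) measurable
  finally show ?thesis .
qed

text \<open>By nonsingularity, \<open>A\<close> is null exactly when its preimage under
  \<open>\<phi> v\<close> is null, for any v. If \<open>A\<close> is \<nu>-null, all inner integrals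
  vanish. If it is not, the inner integrals are positive for all v in [0, 1), a window of positive
  mass contained in every cycle because periods are at least 2.\<close>

lemma null_sets_orbit_measure:
  assumes A [measurable]: "A \<in> sets \<nu>"
  shows "emeasure orbit_measure A = 0 \<longleftrightarrow> emeasure \<nu> A = 0"
proof
  have pre [measurable]: "\<phi> v -` A \<inter> space \<nu> \<in> sets \<nu>" if "v \<in> T" for v
    using measurable_sets[OF flow_measurable_at[OF that] A] .
  have null: "emeasure \<nu> A = 0 \<longleftrightarrow> emeasure base_measure (\<phi> v -` A \<inter> space \<nu>) = 0" if v: "v \<in> T" for v
  proof -
    have "emeasure \<nu> A = 0 \<longleftrightarrow> emeasure \<nu> (\<phi> v -` A \<inter> space \<nu>) = 0"
      using nonsingular v A unfolding nonsingular_flow_def by blast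
    then show ?thesis unfolding null_sets_base_measure[OF pre[OF v]] .
  qed
  have int: "(\<integral>\<^sup>+s. indicator A (\<phi> v s) \<partial>base_measure) = emeasure base_measure (\<phi> v -` A \<inter> space \<nu>)"
    if v: "v \<in> T" for v
  proof -
    have "(\<integral>\<^sup>+s. indicator A (\<phi> v s) \<partial>base_measure) =
        (\<integral>\<^sup>+s. indicator (\<phi> v -` A \<inter> space \<nu>) s \<partial>base_measure)"
      by (intro nn_integral_cong) (auto simp: indicator_def)
    also have "\<dots> = emeasure base_measure (\<phi> v -` A \<inter> space \<nu>)"
      using pre[OF v] by (intro nn_integral_indicator) simp
    finally show ?thesis .
  qed
  {
    assume A0: "emeasure \<nu> A = 0"
    have "emeasure orbit_measure A \<le>
        (\<integral>\<^sup>+v. \<integral>\<^sup>+s. indicator A (\<phi> v s) \<partial>base_measure \<partial>time_measure T)"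
      unfolding emeasure_orbit_Fubini[OF A] by (intro nn_integral_mono) (auto simp: indicator_def)
    also have "\<dots> = (\<integral>\<^sup>+v. 0 \<partial>time_measure T)"
      using null A0 int by (intro nn_integral_cong) auto
    finally show "emeasure orbit_measure A = 0" by simp
  }
  assume "emeasure orbit_measure A = 0"
  then have zero: "(\<integral>\<^sup>+v. \<integral>\<^sup>+s. indicator {0..<period s} v * indicator A (\<phi> v s) \<partial>base_measure \<partial>time_measure T) = 0"
    unfolding emeasure_orbit_Fubini[OF A] .
  note Icc = time_Ico_sets[of 0 1]
  show "emeasure \<nu> A = 0"
  proof (rule ccontr)
    assume "emeasure \<nu> A \<noteq> 0"
    then have pos: "(\<integral>\<^sup>+s. indicator A (\<phi> v s) \<partial>base_measure) \<noteq> 0" if "v \<in> T" for v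
      using null int that by simp
    interpret B: finite_measure base_measure by (rule finite_base_measure)
    have meas [measurable]: "(\<lambda>v. \<integral>\<^sup>+s. indicator A (\<phi> v s) \<partial>base_measure) \<in> borel_measurable (time_measure T)"
      by measurable
    have "(\<integral>\<^sup>+v. indicator ({0..<1} \<inter> T) v * (\<integral>\<^sup>+s. indicator A (\<phi> v s) \<partial>base_measure) \<partial>time_measure T) \<le>
       (\<integral>\<^sup>+v. \<integral>\<^sup>+s. indicator {0..<period s} v * indicator A (\<phi> v s) \<partial>base_measure \<partial>time_measure T)"
    proof (intro nn_integral_mono)
      fix v assume "v \<in> space (time_measure T)"
      then have "indicator ({0..<1} \<inter> T) v * (\<integral>\<^sup>+s. indicator A (\<phi> v s) \<partial>base_measure) =
          (\<integral>\<^sup>+s. indicator ({0..<1} \<inter> T) v * indicator A (\<phi> v s) \<partial>base_measure)"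
        by (intro nn_integral_cmult[symmetric]) measurable
      also have "\<dots> \<le> (\<integral>\<^sup>+s. indicator {0..<period s} v * indicator A (\<phi> v s) \<partial>base_measure)"
      proof (rule nn_integral_mono)
        fix s assume "s \<in> space base_measure"
        then show "indicator ({0..<1} \<inter> T) v * indicator A (\<phi> v s) \<le> (indicator {0..<period s} v * indicator A (\<phi> v s) :: ennreal)"
          using period_ge_2[of s] by (auto simp: indicator_def)
      qed
      finally show "indicator ({0..<1} \<inter> T) v * (\<integral>\<^sup>+s. indicator A (\<phi> v s) \<partial>base_measure) \<le>
         (\<integral>\<^sup>+s. indicator {0..<period s} v * indicator A (\<phi> v s) \<partial>base_measure)" .
    qed
    then have "(\<integral>\<^sup>+v. indicator ({0..<1} \<inter> T) v * (\<integral>\<^sup>+s. indicator A (\<phi> v s) \<partial>base_measure) \<partial>time_measure T) = 0"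
      using zero by simp
    then have "AE v in time_measure T. indicator ({0..<1} \<inter> T) v * (\<integral>\<^sup>+s. indicator A (\<phi> v s) \<partial>base_measure) = 0"
      using Icc by (subst (asm) nn_integral_0_iff_AE) auto
    then have "AE v in time_measure T. v \<notin> {0..<1} \<inter> T"
      by eventually_elim (use pos in \<open>auto simp: indicator_def\<close>)
    then show False
      unfolding AE_iff_null_sets[OF Icc, symmetric] null_sets_def
      using emeasure_time_Ico_unit by simp
  qed
qed

lemma AE_orbit_measure: "(AE s in orbit_measure. Q s) \<longleftrightarrow> (AE s in \<nu>. Q s)"
proof -
  have "null_sets orbit_measure = null_sets \<nu>"
    using null_sets_orbit_measure by (auto simp: null_sets_def)
  then show ?thesis by (simp add: eventually_ae_filter)
qed

section \<open>The density of \<nu> with respect to the orbit measure\<close>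

sublocale orbit: finite_measure orbit_measure by (rule finite_orbit_measure)

lemma absolutely_continuous_orbit: "absolutely_continuous orbit_measure \<nu>"
  using null_sets_orbit_measure by (auto simp: absolutely_continuous_def null_sets_def)

text \<open>The density r = d\<nu>/d\<mu> of the overview. Passing to real values is harmless: the
  derivative is finite almost everywhere because \<nu> is sigma-finite.\<close>

definition orbit_density :: "'s \<Rightarrow> real" where
  "orbit_density s = enn2real (RN_deriv orbit_measure \<nu> s)"

lemma orbit_density_measurable [measurable]: "orbit_density \<in> borel_measurable \<nu>"
proof -
  have "orbit_density \<in> borel_measurable orbit_measure" unfolding orbit_density_def[abs_def] by measurable
  then show ?thesis by (simp cong: measurable_cong_sets)
qed

lemma orbit_density_nonneg [simp]: "0 \<le> orbit_density s"
  by (simp add: orbit_density_def)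

lemma density_orbit_density: "density orbit_measure (\<lambda>s. ennreal (orbit_density s)) = \<nu>"
proof -
  have "AE s in orbit_measure. RN_deriv orbit_measure \<nu> s \<noteq> \<infinity>"
    by (rule orbit.RN_deriv_finite[OF sigma_finite_base absolutely_continuous_orbit]) simp
  then have "AE s in orbit_measure. ennreal (orbit_density s) = RN_deriv orbit_measure \<nu> s"
    by eventually_elim (simp add: orbit_density_def ennreal_enn2real_if)
  then have "density orbit_measure (\<lambda>s. ennreal (orbit_density s)) = density orbit_measure (RN_deriv orbit_measure \<nu>)"
    by (intro density_cong) auto
  also have "\<dots> = \<nu>"
    by (rule orbit.density_RN_deriv[OF absolutely_continuous_orbit]) simp
  finally show ?thesis .
qed

lemma nn_integral_orbit_density:
  "f \<in> borel_measurable \<nu> \<Longrightarrow> (\<integral>\<^sup>+s. f s \<partial>\<nu>) = (\<integral>\<^sup>+s. ennreal (orbit_density s) * f s \<partial>orbit_measure)"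
  using nn_integral_density[of "\<lambda>s. ennreal (orbit_density s)" orbit_measure f] density_orbit_density
  by (simp cong: measurable_cong_sets)

text \<open>Where a density vanishes, the measure it defines has no mass.\<close>

lemma AE_orbit_density_pos: "AE s in \<nu>. 0 < orbit_density s"
proof -
  have "AE s in density orbit_measure (\<lambda>s. ennreal (orbit_density s)). 0 < orbit_density s"
    by (subst AE_density) auto
  then show ?thesis unfolding density_orbit_density .
qed

text \<open>Since \<mu> is invariant and \<nu> = r \<mu>, moving \<nu> by
  \<open>\<phi> (- t)\<close> only replaces r s by r (\<phi> t s). Relative to \<nu> the density is
  the quotient, and Radon-Nikodym derivatives are unique.\<close>

lemma AE_flow_density:
  assumes t: "t \<in> T"
  shows "AE s in \<nu>. flow_density \<nu> \<phi> t s = orbit_density (\<phi> t s) / orbit_density s"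
proof -
  let ?N = "distr \<nu> \<nu> (\<phi> (- t))" and ?f = "\<lambda>s. ennreal (orbit_density (\<phi> t s) / orbit_density s)"
  have [measurable]: "\<phi> t \<in> measurable \<nu> \<nu>" "\<phi> (- t) \<in> measurable \<nu> \<nu>"
    using t by auto
  have "density \<nu> ?f = ?N"
  proof (rule measure_eqI)
    fix A assume "A \<in> sets (density \<nu> ?f)"
    then have A [measurable]: "A \<in> sets \<nu>" by simp
    have "emeasure (density \<nu> ?f) A = (\<integral>\<^sup>+s. ?f s * indicator A s \<partial>\<nu>)"
      by (intro emeasure_density) measurable
    also have "\<dots> = (\<integral>\<^sup>+s. ennreal (orbit_density s) * (?f s * indicator A s) \<partial>orbit_measure)"
      by (rule nn_integral_orbit_density) measurable
    \<comment> \<open>The factor r s cancels, and s is rewritten as \<phi> (- t) (\<phi> t s), so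
      that the integrand depends on \<phi> t s alone and invariance applies.\<close>
    also have "\<dots> = (\<integral>\<^sup>+s. ennreal (orbit_density (\<phi> t s)) * indicator A (\<phi> (- t) (\<phi> t s)) \<partial>orbit_measure)"
    proof (rule nn_integral_cong_AE)
      have "AE s in orbit_measure. 0 < orbit_density s" using AE_orbit_density_pos by (simp add: AE_orbit_measure)
      then show "AE s in orbit_measure. ennreal (orbit_density s) * (?f s * indicator A s) =
          ennreal (orbit_density (\<phi> t s)) * indicator A (\<phi> (- t) (\<phi> t s))"
        using AE_space
      proof eventually_elim
        case (elim s)
        then have "ennreal (orbit_density s) * ?f s = ennreal (orbit_density (\<phi> t s))"
          by (subst ennreal_mult[symmetric]) auto
        then show ?case using elim t by (simp add: flow_cancel mult.assoc[symmetric])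
      qed
    qed
    also have "\<dots> = (\<integral>\<^sup>+s. ennreal (orbit_density s) * indicator A (\<phi> (- t) s) \<partial>orbit_measure)"
      by (rule nn_integral_orbit_invariant[OF _ t]) measurable
    also have "\<dots> = (\<integral>\<^sup>+s. indicator A (\<phi> (- t) s) \<partial>\<nu>)"
      by (rule nn_integral_orbit_density[symmetric]) measurable
    also have "\<dots> = emeasure ?N A"
    proof -
      have "(\<integral>\<^sup>+s. indicator A s \<partial>?N) = (\<integral>\<^sup>+s. indicator A (\<phi> (- t) s) \<partial>\<nu>)"
        by (rule nn_integral_distr) measurable
      then show ?thesis by simp
    qed
    finally show "emeasure (density \<nu> ?f) A = emeasure ?N A" .
  qed simp
  then have "AE s in \<nu>. ?f s = RN_deriv \<nu> ?N s"
    by (intro RN_deriv_unique) measurable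
  then show ?thesis
  proof eventually_elim
    case (elim s)
    then show ?case unfolding flow_density_def elim[symmetric] by simp
  qed
qed

end

section \<open>Cyclic kernels\<close>

lemma int_quot_eq_floor: "0 < a \<Longrightarrow> int_quot a x = \<lfloor>x / a\<rfloor>"
  unfolding int_quot_def
  by (rule Greatest_equality) (auto simp: pos_le_divide_eq le_floor_iff intro: floor_divide_lower)

lemma real_rem_bounds:
  assumes "0 < a" shows "0 \<le> real_rem a x" "real_rem a x < a"
  using floor_divide_lower[OF assms, of x] floor_divide_upper[OF assms, of x]
  by (simp_all add: real_rem_def int_quot_eq_floor[OF assms] algebra_simps)

lemma borel_measurable_power_int:
  fixes f :: "'a \<Rightarrow> 'b::real_normed_field"
  assumes [measurable]: "f \<in> borel_measurable M" "n \<in> measurable M (count_space UNIV)"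
  shows "(\<lambda>x. f x powi n x) \<in> borel_measurable M"
proof (rule measurable_compose_countable[OF _ assms(2)])
  fix i :: int
  show "(\<lambda>x. f x powi i) \<in> borel_measurable M"
    by (cases "0 \<le> i") (simp_all add: power_int_def)
qed

context time_set
begin

lemma two_in_period_range: "2 \<in> period_range T"
  by (simp add: period_range_def)

lemma period_range_subset: "period_range T \<subseteq> T \<inter> {0<..}"
  using time_cases by (auto simp: period_range_def)

lemma period_range_measurable [measurable]: "period_range T \<in> sets borel"
proof -
  have "closed ({t \<in> \<int>. 2 \<le> t} :: real set)" by (rule closed_subset_Ints) auto
  then show ?thesis by (auto simp: period_range_def)
qed

lemma real_rem_in_time:
  assumes "a \<in> T" "x \<in> T" shows "real_rem a x \<in> T"
  using assms by (simp add: real_rem_def)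

lemma AE_strip_fst:
  assumes "sigma_finite_measure \<sigma>" and [measurable]: "q \<in> borel_measurable \<sigma>"
    and Q [measurable]: "{z \<in> space \<sigma>. Q z} \<in> sets \<sigma>" and AE: "AE z in \<sigma>. Q z"
  shows "AE x in strip_measure T \<sigma> q. Q (fst x)"
proof -
  interpret S: sigma_finite_measure \<sigma> by fact
  interpret L: sigma_finite_measure "time_measure T" by (rule sigma_finite_time_measure)
  interpret pair_sigma_finite \<sigma> "time_measure T" ..
  have "AE x in \<sigma> \<Otimes>\<^sub>M time_measure T. Q (fst x)"
  proof (rule AE_pair_measure)
    have "{x \<in> space (\<sigma> \<Otimes>\<^sub>M time_measure T). Q (fst x)} = fst -` {z \<in> space \<sigma>. Q z} \<inter> space (\<sigma> \<Otimes>\<^sub>M time_measure T)"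
      by (auto simp: space_pair_measure)
    also have "\<dots> \<in> sets (\<sigma> \<Otimes>\<^sub>M time_measure T)" by (intro measurable_sets[OF measurable_fst Q])
    finally show "{x \<in> space (\<sigma> \<Otimes>\<^sub>M time_measure T). Q (fst x)} \<in> sets (\<sigma> \<Otimes>\<^sub>M time_measure T)" .
    show "AE z in \<sigma>. AE v in time_measure T. Q (fst (z, v))"
      using AE by eventually_elim simp
  qed
  then show ?thesis
    unfolding strip_measure_def by (subst AE_restrict_space_iff) (auto intro: strip_set_measurable)
qed

lemma space_strip: "space (strip_measure T \<sigma> q) = {(z, v). z \<in> space \<sigma> \<and> v \<in> T \<and> 0 \<le> v \<and> v < q z}"
  by (auto simp: strip_measure_def space_restrict_space space_pair_measure)

lemma measurable_strip_components:
  "fst \<in> measurable (strip_measure T \<sigma> q) \<sigma>" "snd \<in> measurable (strip_measure T \<sigma> q) (time_measure T)"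
  unfolding strip_measure_def by (intro measurable_restrict_space1 measurable_fst measurable_snd)+

lemma measurable_into_strip:
  assumes "f \<in> measurable M \<sigma>" "g \<in> measurable M (time_measure T)"
    and "\<And>x. x \<in> space M \<Longrightarrow> 0 \<le> g x \<and> g x < q (f x)"
  shows "(\<lambda>x. (f x, g x)) \<in> measurable M (strip_measure T \<sigma> q)"
  unfolding strip_measure_def using assms by (intro measurable_restrict_space2) auto

text \<open>The function \<open>g\<close> is measurable on the strip only, so the map to z and the
  remainder of v + t modulo q z must be measurable into the strip; the bounds on
  \<open>real_rem\<close> ensure this.\<close>

lemma cyclic_kernel_measurable:
  fixes b :: "'z \<Rightarrow> 'k::{real_normed_field, banach, second_countable_topology}"
  assumes q [measurable]: "q \<in> borel_measurable \<sigma>" and b [measurable]: "b \<in> borel_measurable \<sigma>"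
    and g: "g \<in> borel_measurable (strip_measure T \<sigma> q)"
    and pos: "\<And>z. z \<in> space \<sigma> \<Longrightarrow> q z \<in> T \<and> 0 < q z"
  shows "(\<lambda>(t, x). cyclic_kernel q b g t x) \<in> borel_measurable (time_measure T \<Otimes>\<^sub>M strip_measure T \<sigma> q)"
proof -
  let ?P = "time_measure T \<Otimes>\<^sub>M strip_measure T \<sigma> q"
  define z :: "real \<times> 'z \<times> real \<Rightarrow> 'z" where "z = (\<lambda>x. fst (snd x))"
  define w :: "real \<times> 'z \<times> real \<Rightarrow> real" where "w = (\<lambda>x. snd (snd x) + fst x)"
  have z [measurable]: "z \<in> measurable ?P \<sigma>"
    unfolding z_def by (rule measurable_compose[OF measurable_snd measurable_strip_components(1)])
  have [measurable]: "(\<lambda>x. snd (snd x)) \<in> borel_measurable ?P"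
    by (rule measurable_compose[OF measurable_compose[OF measurable_snd measurable_strip_components(2)] measurable_time_borel])
  have [measurable]: "(\<lambda>x. fst x) \<in> borel_measurable ?P"
    by (rule measurable_compose[OF measurable_fst measurable_time_borel])
  have [measurable]: "w \<in> borel_measurable ?P" unfolding w_def by measurable
  have space: "z x \<in> space \<sigma>" "w x \<in> T" if "x \<in> space ?P" for x
    using that by (auto simp: space_pair_measure space_strip z_def w_def)
  let ?n = "\<lambda>x. \<lfloor>w x / q (z x)\<rfloor>"
  have n: "int_quot (q (z x)) (w x) = ?n x" if "x \<in> space ?P" for x
    using pos[OF space(1)[OF that]] by (simp add: int_quot_eq_floor)
  have [measurable]: "?n \<in> measurable ?P (count_space UNIV)" by measurable
  have rem: "(\<lambda>x. (z x, real_rem (q (z x)) (w x))) \<in> measurable ?P (strip_measure T \<sigma> q)"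
  proof (rule measurable_into_strip)
    show "(\<lambda>x. real_rem (q (z x)) (w x)) \<in> measurable ?P (time_measure T)"
    proof (rule measurable_time_measureI)
      have "(\<lambda>x. w x - q (z x) * of_int (?n x)) \<in> borel_measurable ?P" by measurable
      then show "(\<lambda>x. real_rem (q (z x)) (w x)) \<in> borel_measurable ?P"
        by (rule measurable_cong[THEN iffD1, rotated]) (simp add: real_rem_def n)
      show "real_rem (q (z x)) (w x) \<in> T" if "x \<in> space ?P" for x
        using space[OF that] pos by (intro real_rem_in_time) auto
    qed
    show "0 \<le> real_rem (q (z x)) (w x) \<and> real_rem (q (z x)) (w x) < q (z x)" if "x \<in> space ?P" for x
      using pos[OF space(1)[OF that]] real_rem_bounds by auto
  qed (rule z)
  have "(\<lambda>x. b (z x) powi ?n x * g (z x, real_rem (q (z x)) (w x))) \<in> borel_measurable ?P"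
    by (intro borel_measurable_times borel_measurable_power_int measurable_compose[OF rem g]) measurable
  moreover have "b (z x) powi ?n x * g (z x, real_rem (q (z x)) (w x)) = (case x of (t, y) \<Rightarrow> cyclic_kernel q b g t y)"
    if "x \<in> space ?P" for x
    unfolding n[OF that, symmetric] by (simp add: cyclic_kernel_def case_prod_beta z_def w_def)
  ultimately show ?thesis
    by (rule measurable_cong[THEN iffD1, rotated])
qed

end

lemma second_countable_euclidean: "second_countable (euclidean :: 'a::second_countable_topology topology)"
proof -
  obtain \<B> :: "'a set set" where "countable \<B>" and B: "topological_basis \<B>"
    using ex_countable_basis by blast
  moreover have "\<exists>V\<in>\<B>. x \<in> V \<and> V \<subseteq> U" if "open U" "x \<in> U" for U x
    using topological_basisE[OF B that] by blast
  ultimately show ?thesis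
    unfolding second_countable_def using topological_basis_open[OF B]
    by (intro exI[of _ \<B>]) auto
qed

lemma standard_borel_real: "sets \<sigma> = sets (borel :: real measure) \<Longrightarrow> standard_borel \<sigma>"
  unfolding standard_borel_def using sets_eq_imp_space_eq[of \<sigma> borel]
  by (intro exI[of _ euclidean])
     (auto simp: borel_def completely_metrizable_space_euclidean second_countable_euclidean)

section \<open>Transport of the strip to the real line\<close>

context periodic_flow_space
begin

text \<open>As \<open>q (c s) = period s\<close>, coding the first coordinate carries the fibre over
  s to the fibre of the same length over c s. Equality of the measures follows by comparing iterated
  integrals of indicators.\<close>

lemma strip_transport:
  assumes c [measurable]: "c \<in> borel_measurable \<nu>" and q [measurable]: "q \<in> borel_measurable borel"
    and qc: "\<And>s. s \<in> space \<nu> \<Longrightarrow> q (c s) = period s"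
  defines "\<sigma> \<equiv> distr base_measure (borel :: real measure) c"
  shows "(\<lambda>(s, v). (c s, v)) \<in> measurable (strip_measure T base_measure period) (strip_measure T \<sigma> q)"
    and "strip_measure T \<sigma> q = distr (strip_measure T base_measure period) (strip_measure T \<sigma> q) (\<lambda>(s, v). (c s, v))"
proof -
  let ?S = "strip_measure T base_measure period" and ?S' = "strip_measure T \<sigma> q"
  let ?C = "\<lambda>(s, v). (c s, v)"
  have c' [measurable]: "c \<in> borel_measurable base_measure"
    using c by (simp cong: measurable_cong_sets)
  have sets_sigma [simp, measurable_cong]: "sets \<sigma> = sets borel" by (simp add: \<sigma>_def)
  have q' [measurable]: "q \<in> borel_measurable \<sigma>" using q by (simp cong: measurable_cong_sets)
  have "(\<lambda>x. (c (fst x), snd x)) \<in> measurable ?S ?S'"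
  proof (rule measurable_into_strip)
    show "(\<lambda>x. c (fst x)) \<in> measurable ?S \<sigma>"
      using measurable_compose[OF measurable_strip_components(1) c'] by (simp cong: measurable_cong_sets)
    show "snd \<in> measurable ?S (time_measure T)" by (rule measurable_strip_components)
  qed (auto simp: space_strip qc)
  then show C: "?C \<in> measurable ?S ?S'" by (simp add: case_prod_beta)
  have C2: "?C \<in> measurable (base_measure \<Otimes>\<^sub>M time_measure T) (borel \<Otimes>\<^sub>M time_measure T)"
    by measurable
  show "?S' = distr ?S ?S' ?C"
  proof (rule measure_eqI)
    fix A assume A: "A \<in> sets ?S'"
    then have A': "A \<in> sets (\<sigma> \<Otimes>\<^sub>M time_measure T)"
      using strip_set_measurable[OF q'] unfolding strip_measure_def by (subst (asm) sets_restrict_space_iff) auto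
    then have ind': "(indicator A :: _ \<Rightarrow> ennreal) \<in> borel_measurable (\<sigma> \<Otimes>\<^sub>M time_measure T)" by simp
    have "sets (\<sigma> \<Otimes>\<^sub>M time_measure T) = sets (borel \<Otimes>\<^sub>M time_measure T)"
      by (intro sets_pair_measure_cong) simp_all
    then have ind: "(indicator A :: _ \<Rightarrow> ennreal) \<in> borel_measurable (borel \<Otimes>\<^sub>M time_measure T)"
      using A' by simp
    have "emeasure ?S' A = (\<integral>\<^sup>+x. indicator A x \<partial>?S')" using A by simp
    also have "\<dots> = (\<integral>\<^sup>+z. \<integral>\<^sup>+v. indicator {0..<q z} v * indicator A (z, v) \<partial>time_measure T \<partial>\<sigma>)"
      by (rule nn_integral_strip[OF q' ind'])
    also have "\<dots> = (\<integral>\<^sup>+s. \<integral>\<^sup>+v. indicator {0..<q (c s)} v * indicator A (c s, v) \<partial>time_measure T \<partial>base_measure)"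
      unfolding \<sigma>_def
    proof (rule nn_integral_distr[OF c'])
      interpret L: sigma_finite_measure "time_measure T" by (rule sigma_finite_time_measure)
      have "(indicator {(z, v). 0 \<le> v \<and> v < q z} :: _ \<Rightarrow> ennreal) \<in> borel_measurable (borel \<Otimes>\<^sub>M time_measure T)"
        using strip_set_measurable[OF q] by (simp add: borel_measurable_indicator_iff)
      from borel_measurable_times_ennreal[OF this ind]
      have "(\<lambda>z. \<integral>\<^sup>+v. indicator {(z, v). 0 \<le> v \<and> v < q z} (z, v) * indicator A (z, v) \<partial>time_measure T) \<in> borel_measurable borel"
        by (rule L.borel_measurable_nn_integral_fst)
      then show "(\<lambda>z. \<integral>\<^sup>+v. indicator {0..<q z} v * indicator A (z, v) \<partial>time_measure T) \<in> borel_measurable (distr base_measure borel c)"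
        by (simp add: indicator_def)
    qed
    also have "\<dots> = (\<integral>\<^sup>+s. \<integral>\<^sup>+v. indicator {0..<period s} v * indicator A (?C (s, v)) \<partial>time_measure T \<partial>base_measure)"
      by (intro nn_integral_cong) (simp add: qc)
    also have "\<dots> = (\<integral>\<^sup>+x. indicator A (?C x) \<partial>?S)"
      by (rule nn_integral_strip[OF period_measurable_base measurable_compose[OF C2 ind], symmetric])
    also have "\<dots> = (\<integral>\<^sup>+x. indicator A x \<partial>distr ?S ?S' ?C)"
      using A by (intro nn_integral_distr[symmetric] C) simp
    also have "\<dots> = emeasure (distr ?S ?S' ?C) A" using A by simp
    finally show "emeasure ?S' A = emeasure (distr ?S ?S' ?C) A" .
  qed simp
qed

end

lemma borel_measurable_norm_sum_powr:
  fixes h :: "'i \<Rightarrow> 'a \<Rightarrow> 'k::{real_normed_algebra, second_countable_topology}" and \<alpha> :: real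
  assumes [measurable]: "\<And>t. t \<in> J \<Longrightarrow> h t \<in> borel_measurable M"
  shows "(\<lambda>x. norm (\<Sum>t\<in>J. \<theta> t * h t x) powr \<alpha>) \<in> borel_measurable M"
  by measurable

section \<open>The cyclic kernel of a process generated by a periodic flow\<close>

context periodic_flow_space
begin

text \<open>Real and complex case at once, \<open>A\<close> being the values allowed for the
  cocycle. Norms of linear combinations determine the joint characteristic functions, so the last
  conclusion is what identifies the laws.\<close>

theorem cyclic_representation:
  fixes f :: "real \<Rightarrow> 's \<Rightarrow> 'k::{real_normed_field, euclidean_space}"
  assumes \<alpha>: "0 < \<alpha>" and kernel: "kernel_Lalpha T \<alpha> \<nu> f" and fk: "flow_kernel T \<alpha> \<nu> \<phi> A f"
    and A [measurable]: "A \<in> sets borel" and A1: "1 \<in> A" and A_norm: "\<And>w. w \<in> A \<Longrightarrow> norm w = 1"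
  obtains \<sigma> :: "real measure" and q b g where
    "cyclic_data T \<alpha> A \<sigma> q b g"
    "kernel_Lalpha T \<alpha> (strip_measure T \<sigma> q) (cyclic_kernel q b g)"
    "\<forall>J \<theta>. finite J \<and> J \<subseteq> T \<longrightarrow> (\<integral>s. norm (\<Sum>t\<in>J. \<theta> t * f t s) powr \<alpha> \<partial>\<nu>) =
       (\<integral>x. norm (\<Sum>t\<in>J. \<theta> t * cyclic_kernel q b g t x) powr \<alpha> \<partial>strip_measure T \<sigma> q)"
proof -
  obtain a where a: "cocycle T \<nu> \<phi> A a" and
    f_eq: "\<And>t. t \<in> T \<Longrightarrow> AE s in \<nu>. f t s = a t s * of_real (flow_density \<nu> \<phi> t s powr (1 / \<alpha>)) * f 0 (\<phi> t s)"
    using fk unfolding flow_kernel_def by blast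
  have a_pair: "(\<lambda>(t, s). a t s) \<in> borel_measurable (time_measure T \<Otimes>\<^sub>M \<nu>)"
    and a_mem: "\<And>t s. t \<in> T \<Longrightarrow> s \<in> space \<nu> \<Longrightarrow> a t s \<in> A"
    and a_add: "\<And>t1 t2 s. t1 \<in> T \<Longrightarrow> t2 \<in> T \<Longrightarrow> s \<in> space \<nu> \<Longrightarrow> a (t1 + t2) s = a t1 s * a t2 (\<phi> t1 s)"
    using a by (auto simp: cocycle_def)
  have a_meas: "(\<lambda>x. a (h x) (k x)) \<in> borel_measurable N"
    if "h \<in> measurable N (time_measure T)" "k \<in> measurable N \<nu>" for h k and N :: "'s measure"
    using measurable_compose[OF measurable_Pair[OF that] a_pair] by simp
  have a_norm: "norm (a t s) = 1" if "t \<in> T" "s \<in> space \<nu>" for t s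
    using A_norm a_mem that by blast
  \<comment> \<open>The cocycle identity makes \<open>a 0 s\<close> idempotent, and norm 1 excludes
    the value 0.\<close>
  have a_zero: "a 0 s = 1" if "s \<in> space \<nu>" for s
    using a_add[of 0 0 s] a_norm[of 0 s] that by auto
  have f_meas: "f t \<in> borel_measurable \<nu>" if "t \<in> T" for t
    using kernel that by (simp add: kernel_Lalpha_def in_Lalpha_def)
  have f_int: "integrable \<nu> (\<lambda>s. norm (f t s) powr \<alpha>)" if "t \<in> T" for t
    using kernel that by (simp add: kernel_Lalpha_def in_Lalpha_def)
  have [measurable]: "f 0 \<in> borel_measurable \<nu>" by (rule f_meas) simp

  \<comment> \<open>\<open>F\<close> is h 0 and \<open>ft\<close> is h of the overview. The cocycle
    formula, which \<open>f t\<close> obeys only almost everywhere, is taken as the definition of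
    \<open>ft\<close>, so joint measurability and the periodicity at periodic points hold without
    exceptional sets.\<close>
  define F where "F s = of_real (orbit_density s powr (1 / \<alpha>)) * f 0 s" for s
  have F_meas [measurable]: "F \<in> borel_measurable \<nu>" unfolding F_def by measurable
  define ft where "ft t s = a t s * F (\<phi> t s)" for t s
  have ft_pair: "(\<lambda>x. ft (snd x) (fst x)) \<in> borel_measurable (\<nu> \<Otimes>\<^sub>M time_measure T)"
  proof -
    have "(\<lambda>x. a (snd x) (fst x)) \<in> borel_measurable (\<nu> \<Otimes>\<^sub>M time_measure T)"
      using measurable_compose[OF measurable_pair_swap' a_pair] by (simp add: case_prod_beta)
    then show ?thesis
      unfolding ft_def by (intro borel_measurable_times measurable_compose[OF flow_measurable F_meas] measurable_snd measurable_fst)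
  qed
  have ft_meas [measurable]: "ft t \<in> borel_measurable \<nu>" if "t \<in> T" for t
    unfolding ft_def using that
    by (intro borel_measurable_times a_meas measurable_compose[OF flow_measurable_at F_meas]) auto
  have ft_f: "AE s in \<nu>. of_real (orbit_density s powr (1 / \<alpha>)) * f t s = ft t s" if t: "t \<in> T" for t
    using f_eq[OF t] AE_flow_density[OF t] AE_orbit_density_pos
  proof eventually_elim
    case (elim s)
    have "orbit_density s powr (1 / \<alpha>) * (orbit_density (\<phi> t s) / orbit_density s) powr (1 / \<alpha>) = orbit_density (\<phi> t s) powr (1 / \<alpha>)"
      using elim(3) by (simp add: powr_mult[symmetric])
    then have *: "of_real (orbit_density s powr (1 / \<alpha>)) * of_real ((orbit_density (\<phi> t s) / orbit_density s) powr (1 / \<alpha>)) =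
        (of_real (orbit_density (\<phi> t s) powr (1 / \<alpha>)) :: 'k)"
      unfolding of_real_mult[symmetric] by simp
    have "of_real (orbit_density s powr (1 / \<alpha>)) * f t s =
        a t s * (of_real (orbit_density s powr (1 / \<alpha>)) * of_real ((orbit_density (\<phi> t s) / orbit_density s) powr (1 / \<alpha>))) * f 0 (\<phi> t s)"
      unfolding elim(1,2) by (simp only: ac_simps)
    then show ?case unfolding * ft_def F_def by (simp only: ac_simps)
  qed
  \<comment> \<open>Moving the point by time v shifts all times by v, up to the common factor
    \<open>a v s\<close> of norm 1.\<close>
  have ft_shift: "norm (\<Sum>t\<in>J. \<theta> t * ft t (\<phi> v s)) = norm (\<Sum>t\<in>J. \<theta> t * ft (v + t) s)"
    if "J \<subseteq> T" "v \<in> T" "s \<in> space \<nu>" for J \<theta> v s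
  proof -
    have "(\<Sum>t\<in>J. \<theta> t * ft (v + t) s) = (\<Sum>t\<in>J. a v s * (\<theta> t * ft t (\<phi> v s)))"
    proof (rule sum.cong)
      fix t assume "t \<in> J"
      then have t: "t \<in> T" using that by blast
      then show "\<theta> t * ft (v + t) s = a v s * (\<theta> t * ft t (\<phi> v s))"
        using a_add[of v t s] flow_add[of t v s] that by (simp add: ft_def add.commute)
    qed simp
    then show ?thesis using a_norm[OF that(2,3)] by (simp add: sum_distrib_left[symmetric] norm_mult)
  qed
  \<comment> \<open>At a point of period p the cocycle is multiplicative along the multiples of p;
    negative multiples follow from \<open>a 0 s = 1\<close>.\<close>
  have a_period: "a (of_int n * p) s = a p s powi n" if p: "p \<in> T" "s \<in> space \<nu>" "\<phi> p s = s" for p s n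
  proof -
    have nat: "a (of_nat k * p) s = a p s ^ k \<and> of_nat k * p \<in> T" for k
    proof (induction k)
      case (Suc k)
      then have "a (of_nat k * p + p) s = a (of_nat k * p) s * a p (\<phi> (of_nat k * p) s)"
        using p by (intro a_add) auto
      also have "\<phi> (of_nat k * p) s = s" using period_multiple[OF p, of "int k"] by simp
      finally show ?case using Suc p by (auto simp: algebra_simps)
    qed (use a_zero p in auto)
    show ?thesis
    proof (cases "0 \<le> n")
      case True
      then show ?thesis using nat[of "nat n"] by (simp add: power_int_def)
    next
      case False
      define m where "m = nat (- n)"
      have n: "of_int n * p = - (of_nat m * p)" using False by (simp add: m_def)
      have "a (- (of_nat m * p) + of_nat m * p) s = a (- (of_nat m * p)) s * a (of_nat m * p) (\<phi> (- (of_nat m * p)) s)"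
        using nat p by (intro a_add) auto
      moreover have "\<phi> (- (of_nat m * p)) s = s" using period_multiple[OF p, of n] n by simp
      ultimately have "a (- (of_nat m * p)) s * a p s ^ m = 1" using nat[of m] a_zero p by simp
      then have "a (of_int n * p) s = inverse (a p s ^ m)"
        unfolding n by (metis inverse_unique mult.commute)
      then show ?thesis using False by (simp add: power_int_def m_def power_inverse)
    qed
  qed
  have ft_period: "ft (v + of_int n * p) s = a p s powi n * ft v s"
    if p: "p \<in> T" "s \<in> space \<nu>" "\<phi> p s = s" and v: "v \<in> T" for p s n v
  proof -
    have np: "of_int n * p \<in> T" using p by auto
    show ?thesis
      using a_add[OF np v p(2)] flow_add[OF v np p(2)] period_multiple[OF p, of n] a_period[OF p, of n]
      by (simp add: ft_def add.commute)
  qed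

  \<comment> \<open>The period, the factor gained over one period, and the kernel \<open>ft\<close>
    are now expressed through the code, so that the real line can serve as Z.\<close>
  obtain c :: "'s \<Rightarrow> real" where c [measurable]: "c \<in> borel_measurable \<nu>"
    and c_sets: "\<And>A. A \<in> sets \<nu> \<Longrightarrow> \<exists>B\<in>sets borel. A = c -` B \<inter> space \<nu>"
    using standard_borel_code[OF standard_borel] by metis
  obtain q0 where q0 [measurable]: "q0 \<in> borel_measurable borel" and q0_c: "\<And>s. s \<in> space \<nu> \<Longrightarrow> period s = q0 (c s)"
    using doob_dynkin[OF period_measurable c_sets] by blast
  have a_period_meas: "(\<lambda>s. a (period s) s) \<in> borel_measurable \<nu>"
    by (intro a_meas measurable_time_measureI period_measurable measurable_ident_sets[OF refl]) (rule period_in_time)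
  obtain b0 where b0 [measurable]: "b0 \<in> borel_measurable borel"
    and b0_c: "\<And>s. s \<in> space \<nu> \<Longrightarrow> a (period s) s = b0 (c s)"
    using doob_dynkin[OF a_period_meas c_sets] by blast
  have pair_sets: "\<exists>B\<in>sets (borel \<Otimes>\<^sub>M time_measure T). D = (\<lambda>(s, v). (c s, v)) -` B \<inter> space (\<nu> \<Otimes>\<^sub>M time_measure T)"
    if "D \<in> sets (\<nu> \<Otimes>\<^sub>M time_measure T)" for D
    by (rule vimage_sets_pair[OF _ c_sets that]) simp
  obtain g where g: "g \<in> borel_measurable (borel \<Otimes>\<^sub>M time_measure T)"
    and g_c: "\<And>x. x \<in> space (\<nu> \<Otimes>\<^sub>M time_measure T) \<Longrightarrow> ft (snd x) (fst x) = g ((\<lambda>(s, v). (c s, v)) x)"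
    by (rule doob_dynkin[OF ft_pair pair_sets]) blast+
  \<comment> \<open>Off the range of the code the factored functions may take any value; the
    defaults 2 and 1 keep \<open>q\<close> and \<open>b\<close> admissible everywhere.\<close>
  define q where "q z = (if q0 z \<in> period_range T then q0 z else 2)" for z
  define b where "b z = (if b0 z \<in> A then b0 z else 1)" for z
  define \<sigma> where "\<sigma> = distr base_measure borel c"
  have q_meas [measurable]: "q \<in> borel_measurable borel" unfolding q_def by measurable
  have b_meas [measurable]: "b \<in> borel_measurable borel" unfolding b_def by measurable
  have q_range: "q z \<in> period_range T" for z by (simp add: q_def two_in_period_range)
  have q_pos: "q z \<in> T" "0 < q z" for z using q_range[of z] period_range_subset by auto
  have q_c: "q (c s) = period s" if s: "s \<in> space \<nu>" for s
  proof -
    have "period s \<in> period_range T"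
      using period_in_time[OF s] period_ge_2[OF s] by (auto simp: period_range_def)
    then show ?thesis using q0_c[OF s] by (simp add: q_def)
  qed
  have b_c: "b (c s) = a (period s) s" if s: "s \<in> space \<nu>" for s
    using b0_c[OF s] a_mem[OF period_in_time[OF s] s] by (simp add: b_def)
  have b_mem: "b z \<in> A" for z using A1 by (simp add: b_def)
  have sets_sigma [simp, measurable_cong]: "sets \<sigma> = sets borel" by (simp add: \<sigma>_def)
  have space_sigma [simp]: "space \<sigma> = UNIV" by (simp add: \<sigma>_def)
  let ?S = "strip_measure T base_measure period" and ?S' = "strip_measure T \<sigma> q"
  let ?C = "\<lambda>(s, v). (c s, v)" and ?K = "cyclic_kernel q b g"
  have C: "?C \<in> measurable ?S ?S'" and S': "?S' = distr ?S ?S' ?C"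
    unfolding \<sigma>_def using strip_transport[OF c q_meas q_c] by auto
  have q_sigma: "q \<in> borel_measurable \<sigma>" and b_sigma: "b \<in> borel_measurable \<sigma>"
    using q_meas b_meas by (simp_all cong: measurable_cong_sets)
  have g_strip: "g \<in> borel_measurable ?S'"
  proof -
    have "sets (\<sigma> \<Otimes>\<^sub>M time_measure T) = sets (borel \<Otimes>\<^sub>M time_measure T)"
      by (intro sets_pair_measure_cong) simp_all
    then have "g \<in> borel_measurable (\<sigma> \<Otimes>\<^sub>M time_measure T)" using g by (simp cong: measurable_cong_sets)
    then show ?thesis unfolding strip_measure_def by (rule measurable_restrict_space1)
  qed
  have K_pair: "(\<lambda>(t, x). ?K t x) \<in> borel_measurable (time_measure T \<Otimes>\<^sub>M ?S')"
    by (rule cyclic_kernel_measurable[OF q_sigma b_sigma g_strip]) (use q_pos in auto)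
  have K_meas: "?K t \<in> borel_measurable ?S'" if "t \<in> T" for t
    using measurable_compose_Pair1[OF _ K_pair, of t] that by simp
  \<comment> \<open>Division with remainder writes v + t as a remainder plus n full periods, and the
    n periods contribute the n-th power of \<open>a p s\<close>, which is the power of
    \<open>b\<close> in the kernel.\<close>
  have K_ft: "?K t (c s, v) = ft (v + t) s"
    if s: "s \<in> space \<nu>" "\<phi> (period s) s = s" and v: "v \<in> T" and t: "t \<in> T" for s v t
  proof -
    define p where "p = period s"
    define n where "n = int_quot p (v + t)"
    have p: "p \<in> T" "\<phi> p s = s" using s period_in_time by (auto simp: p_def)
    have r: "real_rem p (v + t) \<in> T" using p v t by (intro real_rem_in_time) auto
    have "?K t (c s, v) = a p s powi n * g (c s, real_rem p (v + t))"
      using q_c[OF s(1)] b_c[OF s(1)] by (simp add: cyclic_kernel_def p_def n_def)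
    also have "g (c s, real_rem p (v + t)) = ft (real_rem p (v + t)) s"
      using g_c[of "(s, real_rem p (v + t))"] s r by (simp add: space_pair_measure)
    also have "a p s powi n * ft (real_rem p (v + t)) s = ft (real_rem p (v + t) + of_int n * p) s"
      using ft_period[OF p(1) s(1) p(2) r] by simp
    finally show ?thesis by (simp add: real_rem_def n_def mult.commute)
  qed
  have AE_good: "AE x in ?S. fst x \<in> space \<nu> \<and> \<phi> (period (fst x)) (fst x) = fst x"
  proof -
    \<comment> \<open>Lifting an almost sure property to the strip by \<open>AE_strip_fst\<close>
      calls for a measurable set; the injective code provides it as before.\<close>
    have "{s \<in> space \<nu>. \<phi> (period s) s = s} \<in> sets \<nu>"
    proof -
      obtain d :: "'s \<Rightarrow> real" where d [measurable]: "d \<in> borel_measurable \<nu>" and inj: "inj_on d (space \<nu>)"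
        using standard_borel_code[OF standard_borel] by metis
      have [measurable]: "(\<lambda>s. \<phi> (period s) s) \<in> measurable \<nu> \<nu>"
        by (intro flow_measurable measurable_time_measureI period_measurable measurable_ident_sets[OF refl]) (rule period_in_time)
      have "{s \<in> space \<nu>. \<phi> (period s) s = s} = {s \<in> space \<nu>. d (\<phi> (period s) s) = d s}"
        using inj period_in_time by (auto dest!: inj_onD)
      also have "\<dots> \<in> sets \<nu>" by measurable
      finally show ?thesis .
    qed
    moreover have "AE s in base_measure. s \<in> space \<nu> \<and> \<phi> (period s) s = s"
      using AE_period[OF periodic] AE_space unfolding AE_base_measure by eventually_elim auto
    moreover interpret B: finite_measure base_measure by (rule finite_base_measure)
    have "sigma_finite_measure base_measure" ..
    ultimately show ?thesis
      by (intro AE_strip_fst) (auto cong: conj_cong)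
  qed

  \<comment> \<open>The chain runs from \<nu> to \<mu> by the density r, from \<mu> to the strip
    over S by the construction of \<mu>, and on to the strip over the line by coding. The
    equivalence of integrability supplies the \<open>in_Lalpha\<close> conditions for the new
    kernel.\<close>
  have transfer:
    "integrable ?S' (\<lambda>x. norm (\<Sum>t\<in>J. \<theta> t * ?K t x) powr \<alpha>) \<longleftrightarrow> integrable \<nu> (\<lambda>s. norm (\<Sum>t\<in>J. \<theta> t * f t s) powr \<alpha>)"
    "(\<integral>s. norm (\<Sum>t\<in>J. \<theta> t * f t s) powr \<alpha> \<partial>\<nu>) = (\<integral>x. norm (\<Sum>t\<in>J. \<theta> t * ?K t x) powr \<alpha> \<partial>?S')"
    if J: "finite J" "J \<subseteq> T" for J \<theta>
  proof -
    let ?f = "\<lambda>s. norm (\<Sum>t\<in>J. \<theta> t * f t s) powr \<alpha>"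
    let ?h = "\<lambda>s. norm (\<Sum>t\<in>J. \<theta> t * ft t s) powr \<alpha>"
    let ?k = "\<lambda>x. norm (\<Sum>t\<in>J. \<theta> t * ?K t x) powr \<alpha>"
    let ?o = "\<lambda>(s, v). \<phi> v s"
    have f_m [measurable]: "?f \<in> borel_measurable \<nu>"
      using f_meas J by (intro borel_measurable_norm_sum_powr) auto
    have h_m [measurable]: "?h \<in> borel_measurable \<nu>"
      using ft_meas J by (intro borel_measurable_norm_sum_powr) auto
    have k_m: "?k \<in> borel_measurable ?S'"
      using K_meas J by (intro borel_measurable_norm_sum_powr) auto
    have f_o: "?f \<in> borel_measurable orbit_measure" and h_o: "?h \<in> borel_measurable orbit_measure"
      and r_o: "orbit_density \<in> borel_measurable orbit_measure"
      using f_m h_m orbit_density_measurable by (simp_all cong: measurable_cong_sets)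
    have "AE s in \<nu>. \<forall>t\<in>J. of_real (orbit_density s powr (1 / \<alpha>)) * f t s = ft t s"
      using J ft_f by (intro AE_finite_allI) auto
    then have fh: "AE s in orbit_measure. orbit_density s *\<^sub>R ?f s = ?h s"
      unfolding AE_orbit_measure
    proof eventually_elim
      case (elim s)
      have "(\<Sum>t\<in>J. \<theta> t * ft t s) = of_real (orbit_density s powr (1 / \<alpha>)) * (\<Sum>t\<in>J. \<theta> t * f t s)"
        unfolding sum_distrib_left using elim by (intro sum.cong) (auto simp: ac_simps)
      then have "?h s = (orbit_density s powr (1 / \<alpha>)) powr \<alpha> * ?f s"
        by (simp add: norm_mult powr_mult)
      then show ?case using \<alpha> by (simp add: powr_powr)
    qed
    have hk: "AE x in ?S. ?h (?o x) = ?k (?C x)"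
      using AE_good AE_space
    proof eventually_elim
      case (elim x)
      obtain s v where x: "x = (s, v)" by (cases x)
      have s: "s \<in> space \<nu>" "\<phi> (period s) s = s" and v: "v \<in> T"
        using elim by (auto simp: x space_strip)
      have "(\<Sum>t\<in>J. \<theta> t * ?K t (c s, v)) = (\<Sum>t\<in>J. \<theta> t * ft (v + t) s)"
        using K_ft[OF s v] J by (intro sum.cong) auto
      then show ?case using ft_shift[OF J(2) v s(1)] by (simp add: x)
    qed
    have h_S: "(\<lambda>x. ?h (?o x)) \<in> borel_measurable ?S"
      by (rule measurable_compose[OF orbit_map_strip h_m])
    have k_S: "(\<lambda>x. ?k (?C x)) \<in> borel_measurable ?S" by (rule measurable_compose[OF C k_m])
    have "integrable \<nu> ?f \<longleftrightarrow> integrable (density orbit_measure (\<lambda>s. ennreal (orbit_density s))) ?f"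
      by (simp add: density_orbit_density)
    also have "\<dots> \<longleftrightarrow> integrable orbit_measure (\<lambda>s. orbit_density s *\<^sub>R ?f s)"
      by (rule integrable_density[OF f_o r_o]) simp
    also have "\<dots> \<longleftrightarrow> integrable orbit_measure ?h"
      using fh f_o h_o r_o by (intro integrable_cong_AE borel_measurable_scaleR) auto
    also have "\<dots> \<longleftrightarrow> integrable ?S (\<lambda>x. ?h (?o x))"
      unfolding orbit_measure_def by (rule integrable_distr_eq[OF orbit_map_strip h_m])
    also have "\<dots> \<longleftrightarrow> integrable ?S (\<lambda>x. ?k (?C x))"
      by (rule integrable_cong_AE[OF h_S k_S hk])
    also have "\<dots> \<longleftrightarrow> integrable ?S' ?k"
      using integrable_distr_eq[OF C k_m] S' by simp
    finally show "integrable ?S' ?k \<longleftrightarrow> integrable \<nu> ?f" by simp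
    have "(\<integral>s. ?f s \<partial>\<nu>) = (\<integral>s. ?f s \<partial>density orbit_measure (\<lambda>s. ennreal (orbit_density s)))"
      by (simp add: density_orbit_density)
    also have "\<dots> = (\<integral>s. orbit_density s *\<^sub>R ?f s \<partial>orbit_measure)"
      by (rule integral_density[OF f_o r_o]) simp
    also have "\<dots> = (\<integral>s. ?h s \<partial>orbit_measure)"
      using fh f_o h_o r_o by (intro integral_cong_AE borel_measurable_scaleR) auto
    also have "\<dots> = (\<integral>x. ?h (?o x) \<partial>?S)"
      unfolding orbit_measure_def by (rule integral_distr[OF orbit_map_strip h_m])
    also have "\<dots> = (\<integral>x. ?k (?C x) \<partial>?S)"
      by (rule integral_cong_AE[OF h_S k_S hk])
    also have "\<dots> = (\<integral>x. ?k x \<partial>?S')"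
      using integral_distr[OF C k_m] S' by simp
    finally show "(\<integral>s. ?f s \<partial>\<nu>) = (\<integral>x. ?k x \<partial>?S')" .
  qed
  have K_int: "integrable ?S' (\<lambda>x. norm (?K t x) powr \<alpha>)" if "t \<in> T" for t
    using transfer(1)[of "{t}" "\<lambda>_. 1"] f_int[OF that] that by simp
  show thesis
  proof
    show "kernel_Lalpha T \<alpha> ?S' ?K"
      using K_pair K_meas K_int by (simp add: kernel_Lalpha_def in_Lalpha_def)
    \<comment> \<open>On the strip v lies in [0, q z), so at t = 0 the quotient is 0 and the kernel
      is \<open>g\<close> itself.\<close>
    have "integrable ?S' (\<lambda>x. norm (g x) powr \<alpha>) \<longleftrightarrow> integrable ?S' (\<lambda>x. norm (?K 0 x) powr \<alpha>)"
    proof (rule Bochner_Integration.integrable_cong)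
      fix x assume "x \<in> space ?S'"
      then obtain z v where x: "x = (z, v)" "0 \<le> v" "v < q z" by (auto simp: space_strip)
      then have "\<lfloor>v / q z\<rfloor> = 0" using q_pos[of z] by (simp add: floor_eq_iff)
      then show "norm (g x) powr \<alpha> = norm (?K 0 x) powr \<alpha>"
        using q_pos[of z] by (simp add: x(1) cyclic_kernel_def int_quot_eq_floor real_rem_def)
    qed simp
    then have "in_Lalpha \<alpha> ?S' g" using g_strip K_int[of 0] by (simp add: in_Lalpha_def)
    moreover have "standard_lebesgue \<sigma>"
    proof -
      interpret B: finite_measure base_measure by (rule finite_base_measure)
      interpret finite_measure \<sigma>
        unfolding \<sigma>_def using c by (intro B.finite_measure_distr) (simp cong: measurable_cong_sets)
      have "sigma_finite_measure \<sigma>" ..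
      then show ?thesis by (simp add: standard_lebesgue_def standard_borel_real)
    qed
    ultimately show "cyclic_data T \<alpha> A \<sigma> q b g"
      unfolding cyclic_data_def using q_sigma b_sigma q_range b_mem by simp
  qed (use transfer(2) in blast)
qed

end

section \<open>Processes on path space\<close>

text \<open>The theorem asks for both summands on one space of pairs of paths: the first path is
  identically 0 on \<open>T\<close>, the second is a copy of \<open>X\<close>.\<close>

definition path_measure :: "real set \<Rightarrow> 'w measure \<Rightarrow> (real \<Rightarrow> 'w \<Rightarrow> 'k::{topological_space, zero}) \<Rightarrow>
    ((real \<Rightarrow> 'k) \<times> (real \<Rightarrow> 'k)) measure" where
  "path_measure T P X = distr P (PiM T (\<lambda>_. borel) \<Otimes>\<^sub>M PiM T (\<lambda>_. borel)) (\<lambda>\<omega>. (\<lambda>t\<in>T. 0 :: 'k, \<lambda>t\<in>T. X t \<omega>))"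

context
  fixes T :: "real set" and P :: "'w measure" and X :: "real \<Rightarrow> 'w \<Rightarrow> 'k::{topological_space, zero}"
  assumes X: "stoch_process T P X"
begin

interpretation prob_space P using X by (simp add: stoch_process_def)

lemma path_map_measurable:
  "(\<lambda>\<omega>. (\<lambda>t\<in>T. 0 :: 'k, \<lambda>t\<in>T. X t \<omega>)) \<in> measurable P (PiM T (\<lambda>_. borel) \<Otimes>\<^sub>M PiM T (\<lambda>_. borel))"
  using X by (intro measurable_Pair measurable_restrict) (auto simp: stoch_process_def)

lemma path_coordinate_measurable:
  "t \<in> T \<Longrightarrow> (\<lambda>\<omega>. snd \<omega> t) \<in> measurable (path_measure T P X) borel"
  using measurable_compose[OF measurable_snd measurable_component_singleton[of t T "\<lambda>_. borel"]]
  by (simp add: path_measure_def cong: measurable_cong_sets)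

lemma prob_space_path_measure: "prob_space (path_measure T P X)"
  unfolding path_measure_def by (intro prob_space_distr path_map_measurable)

lemma integral_path_measure:
  fixes h :: "_ \<Rightarrow> complex"
  assumes "h \<in> borel_measurable (path_measure T P X)"
  shows "(\<integral>\<omega>. h \<omega> \<partial>path_measure T P X) = (\<integral>\<omega>. h (\<lambda>t\<in>T. 0 :: 'k, \<lambda>t\<in>T. X t \<omega>) \<partial>P)"
  using assms unfolding path_measure_def
  by (intro integral_distr path_map_measurable) (simp cong: measurable_cong_sets)

text \<open>The reindexing \<open>k\<close> covers both the identity, for equality in law, and the
  shift by h, for stationarity.\<close>

lemma path_measure_fdd:
  assumes J: "J \<subseteq> T" and h: "\<And>t. t \<in> J \<Longrightarrow> k t \<in> T"
  shows "distr (path_measure T P X) (PiM J (\<lambda>_. borel)) (\<lambda>\<omega>. \<lambda>t\<in>J. snd \<omega> (k t)) =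
    distr P (PiM J (\<lambda>_. borel)) (\<lambda>\<omega>. \<lambda>t\<in>J. X (k t) \<omega>)"
proof -
  have "(\<lambda>\<omega>. \<lambda>t\<in>J. snd \<omega> (k t)) \<in> measurable (path_measure T P X) (PiM J (\<lambda>_. borel))"
    using h by (intro measurable_restrict path_coordinate_measurable) auto
  then have "(\<lambda>\<omega>. \<lambda>t\<in>J. snd \<omega> (k t)) \<in>
      measurable (PiM T (\<lambda>_. borel :: 'k measure) \<Otimes>\<^sub>M PiM T (\<lambda>_. borel :: 'k measure)) (PiM J (\<lambda>_. borel))"
    by (simp add: path_measure_def cong: measurable_cong_sets)
  from distr_distr[OF this path_map_measurable]
  have "distr (path_measure T P X) (PiM J (\<lambda>_. borel)) (\<lambda>\<omega>. \<lambda>t\<in>J. snd \<omega> (k t)) =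
      distr P (PiM J (\<lambda>_. borel)) ((\<lambda>\<omega>. \<lambda>t\<in>J. snd \<omega> (k t)) \<circ> (\<lambda>\<omega>. (\<lambda>t\<in>T. 0 :: 'k, \<lambda>t\<in>T. X t \<omega>)))"
    unfolding path_measure_def .
  also have "(\<lambda>\<omega>. \<lambda>t\<in>J. snd \<omega> (k t)) \<circ> (\<lambda>\<omega>. (\<lambda>t\<in>T. 0 :: 'k, \<lambda>t\<in>T. X t \<omega>)) = (\<lambda>\<omega>. \<lambda>t\<in>J. X (k t) \<omega>)"
    using h by (auto simp: fun_eq_iff restrict_def)
  finally show ?thesis .
qed

lemma stoch_process_path:
  "stoch_process T (path_measure T P X) (\<lambda>t \<omega>. snd \<omega> t)"
  using prob_space_path_measure path_coordinate_measurable by (simp add: stoch_process_def)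

lemma same_fdd_path: "same_fdd T P X (path_measure T P X) (\<lambda>t \<omega>. snd \<omega> t)"
  unfolding same_fdd_def
proof (intro allI impI)
  fix J assume "finite J \<and> J \<subseteq> T"
  then have J: "J \<subseteq> T" and k: "\<And>t. t \<in> J \<Longrightarrow> t \<in> T" by auto
  show "distr P (PiM J (\<lambda>_. borel)) (\<lambda>\<omega>. \<lambda>t\<in>J. X t \<omega>) =
      distr (path_measure T P X) (PiM J (\<lambda>_. borel)) (\<lambda>\<omega>. \<lambda>t\<in>J. snd \<omega> t)"
    by (rule path_measure_fdd[OF J k, symmetric])
qed

lemma stationary_path:
  assumes "stationary T P X" and "\<And>s t. s \<in> T \<Longrightarrow> t \<in> T \<Longrightarrow> s + t \<in> T"
  shows "stationary T (path_measure T P X) (\<lambda>t \<omega>. snd \<omega> t)"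
  unfolding stationary_def
proof (intro conjI ballI stoch_process_path)
  fix h assume h: "h \<in> T"
  show "same_fdd T (path_measure T P X) (\<lambda>t \<omega>. snd \<omega> (t + h)) (path_measure T P X) (\<lambda>t \<omega>. snd \<omega> t)"
    unfolding same_fdd_def
  proof (intro allI impI)
    fix J assume J: "finite J \<and> J \<subseteq> T"
    have eq: "distr P (PiM J (\<lambda>_. borel)) (\<lambda>\<omega>. \<lambda>t\<in>J. X (t + h) \<omega>) = distr P (PiM J (\<lambda>_. borel)) (\<lambda>\<omega>. \<lambda>t\<in>J. X t \<omega>)"
      using assms(1) h J by (simp add: stationary_def same_fdd_def)

    have J: "J \<subseteq> T" and k: "\<And>t. t \<in> J \<Longrightarrow> t \<in> T" "\<And>t. t \<in> J \<Longrightarrow> t + h \<in> T"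
      using J h assms(2) by auto
    show "distr (path_measure T P X) (PiM J (\<lambda>_. borel)) (\<lambda>\<omega>. \<lambda>t\<in>J. snd \<omega> (t + h)) =
        distr (path_measure T P X) (PiM J (\<lambda>_. borel)) (\<lambda>\<omega>. \<lambda>t\<in>J. snd \<omega> t)"
      by (rule trans[OF path_measure_fdd[OF J k(2)] trans[OF eq path_measure_fdd[OF J k(1), symmetric]]])
  qed
qed

end

section \<open>The zero process as first summand\<close>

lemma (in prob_space) indep_var_const:
  assumes c: "c \<in> space N" and Y: "random_variable L Y"
  shows "indep_var N (\<lambda>_. c) L Y"
  unfolding indep_var_eq
proof (intro conjI)
  let ?A = "sigma_sets (space M) {(\<lambda>_. c) -` A \<inter> space M |A. A \<in> sets N}"
  let ?B = "sigma_sets (space M) {Y -` A \<inter> space M |A. A \<in> sets L}"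
  show "random_variable N (\<lambda>_. c)" using c by simp
  \<comment> \<open>A constant generates the trivial sigma-algebra, whose events have probability 0
    or 1 and so are independent of everything.\<close>
  have A: "?A \<subseteq> {{}, space M}"
    by (rule sigma_algebra.sigma_sets_subset[OF sigma_algebra_trivial]) auto
  have B: "?B \<subseteq> events"
    using Y by (intro sets.sigma_sets_subset) auto
  show "indep_set ?A ?B"
  proof (rule indep_setI)
    show "?A \<subseteq> events" using A by (rule subset_trans) auto
    show "?B \<subseteq> events" by (rule B)
    fix a b assume "a \<in> ?A" "b \<in> ?B"
    then have "a = {} \<or> a = space M" "b \<subseteq> space M"
      using A B sets.sets_into_space by blast+
    then show "prob (a \<inter> b) = prob a * prob b" by (auto simp: prob_space Int_absorb1)
  qed
qed (rule Y)

lemma stationary_zero: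
  "prob_space Q \<Longrightarrow> stationary T Q (\<lambda>t \<omega>. 0)"
  by (simp add: stationary_def stoch_process_def same_fdd_def)

lemma indep_processes_zero:
  assumes "stoch_process T Q Y"
  shows "indep_processes T Q (\<lambda>t \<omega>. 0) Y"
proof -
  interpret prob_space Q using assms by (simp add: stoch_process_def)
  show ?thesis
    unfolding indep_processes_def using assms
    by (intro indep_var_const measurable_restrict) (auto simp: space_PiM stoch_process_def)
qed

lemma kernel_Lalpha_null_measure:
  assumes "(\<lambda>(t, s). f t s) \<in> borel_measurable (time_measure T \<Otimes>\<^sub>M M)"
    and "\<And>t. t \<in> T \<Longrightarrow> f t \<in> borel_measurable M"
  shows "kernel_Lalpha T \<alpha> (null_measure M) f"
proof -
  have "sets (time_measure T \<Otimes>\<^sub>M null_measure M) = sets (time_measure T \<Otimes>\<^sub>M M)"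
    by (intro sets_pair_measure_cong) simp_all
  then show ?thesis
    using assms unfolding kernel_Lalpha_def in_Lalpha_def by (simp cong: measurable_cong_sets)
qed

lemma (in time_set) alternating_measurable: "alternating T \<in> borel_measurable (time_measure T)"
  by (cases "T = \<int>") (simp_all add: alternating_def[abs_def] time_measure_def)

text \<open>For the zero control measure both sides of the formula for the characteristic functions
  equal 1; what remains is measurability of the kernel.\<close>

lemma (in time_set) stable_integral_real_zero:
  assumes "prob_space Q"
  shows "stable_integral_real T \<alpha> Q (\<lambda>t \<omega>. 0) (null_measure (count_space {1, 2})) (spectral_kernel_real T)"
proof -
  interpret prob_space Q by fact
  have "(\<lambda>(t, k). spectral_kernel_real T t k) \<in> borel_measurable (time_measure T \<Otimes>\<^sub>M count_space {1, 2})"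
    unfolding spectral_kernel_real_def case_prod_beta
    by (intro borel_measurable_add borel_measurable_times measurable_compose[OF measurable_fst alternating_measurable]
        measurable_compose[OF measurable_snd, of _ "count_space {1, 2 :: nat}"]) auto
  then have "kernel_Lalpha T \<alpha> (null_measure (count_space {1, 2})) (spectral_kernel_real T)"
    by (rule kernel_Lalpha_null_measure) simp
  then show ?thesis
    using assms prob_space by (simp add: stable_integral_real_def stoch_process_def)
qed

lemma (in time_set) stable_integral_complex_zero:
  assumes "prob_space Q"
  shows "stable_integral_complex T \<alpha> Q (\<lambda>t \<omega>. 0) (null_measure (restrict_space borel D)) spectral_kernel_complex"
proof -
  interpret prob_space Q by fact
  have [measurable]: "(\<lambda>x. x) \<in> borel_measurable (restrict_space borel D)"
    by (rule measurable_restrict_space1) simp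
  have "(\<lambda>(t, x). spectral_kernel_complex t x) \<in> borel_measurable (time_measure T \<Otimes>\<^sub>M restrict_space borel D)"
  proof -
    have [measurable]: "(\<lambda>z. fst z) \<in> borel_measurable (time_measure T \<Otimes>\<^sub>M restrict_space borel D)"
      "(\<lambda>z. snd z) \<in> borel_measurable (time_measure T \<Otimes>\<^sub>M restrict_space borel D)"
      by (rule measurable_compose[OF measurable_fst measurable_time_borel])
         (rule measurable_compose[OF measurable_snd], measurable)
    show ?thesis unfolding spectral_kernel_complex_def case_prod_beta by measurable
  qed
  then have "kernel_Lalpha T \<alpha> (null_measure (restrict_space borel D)) spectral_kernel_complex"
    by (rule kernel_Lalpha_null_measure) (simp add: spectral_kernel_complex_def[abs_def])
  then show ?thesis
    using assms prob_space by (simp add: stable_integral_complex_def stoch_process_def)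
qed

lemma finite_null_measure: "finite_measure (null_measure M)"
  by (rule finite_measureI) simp

lemma sets_spheres:
  "{- 1, 1 :: real} \<in> sets borel" "{w :: complex. cmod w = 1} \<in> sets borel"
  by simp_all

section \<open>Assembly of the real and the complex case\<close>

theorem theorem3p1:
  fixes T :: "real set" and \<alpha> :: real
    and P :: "'w measure" and \<nu> :: "'s measure" and \<phi> :: "real \<Rightarrow> 's \<Rightarrow> 's"
    and X :: "real \<Rightarrow> 'w \<Rightarrow> real" and Y :: "real \<Rightarrow> 'w \<Rightarrow> complex"
  assumes "T = \<int> \<or> T = UNIV" and "0 < \<alpha>" and "\<alpha> < 2"
  shows
    "(generated_by_flow_real T \<alpha> P X \<nu> \<phi> \<and> periodic_flow T \<nu> \<phi> \<longrightarrow>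
       (\<exists>(Q :: ((real \<Rightarrow> real) \<times> (real \<Rightarrow> real)) measure) X1 X2
          (\<eta> :: nat measure) (\<sigma> :: real measure) q b g.
          stationary T Q X1 \<and> stationary T Q X2 \<and> indep_processes T Q X1 X2 \<and>
          same_fdd T P X Q (\<lambda>t \<omega>. X1 t \<omega> + X2 t \<omega>) \<and>
          finite_measure \<eta> \<and> sets \<eta> = sets (count_space {1, 2}) \<and>
          stable_integral_real T \<alpha> Q X1 \<eta> (spectral_kernel_real T) \<and>
          cyclic_data T \<alpha> {-1, 1} \<sigma> q b g \<and>
          stable_integral_real T \<alpha> Q X2 (strip_measure T \<sigma> q) (cyclic_kernel q b g))) \<and>
     (generated_by_flow_complex T \<alpha> P Y \<nu> \<phi> \<and> periodic_flow T \<nu> \<phi> \<longrightarrow>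
       (\<exists>(Q :: ((real \<Rightarrow> complex) \<times> (real \<Rightarrow> complex)) measure) Y1 Y2
          (\<eta> :: real measure) (\<sigma> :: real measure) q b g.
          stationary T Q Y1 \<and> stationary T Q Y2 \<and> indep_processes T Q Y1 Y2 \<and>
          same_fdd T P Y Q (\<lambda>t \<omega>. Y1 t \<omega> + Y2 t \<omega>) \<and>
          finite_measure \<eta> \<and> sets \<eta> = sets (restrict_space borel (dual_time T)) \<and>
          stable_integral_complex T \<alpha> Q Y1 \<eta> spectral_kernel_complex \<and>
          cyclic_data T \<alpha> {w. cmod w = 1} \<sigma> q b g \<and>
          stable_integral_complex T \<alpha> Q Y2 (strip_measure T \<sigma> q) (cyclic_kernel q b g)))"
proof (intro conjI impI)
  interpret time_set T by standard (rule assms(1))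
  {
    assume gen: "generated_by_flow_real T \<alpha> P X \<nu> \<phi> \<and> periodic_flow T \<nu> \<phi>"
    then obtain f where stat: "stationary T P X" and f: "stable_integral_real T \<alpha> P X \<nu> f"
      and fk: "flow_kernel T \<alpha> \<nu> \<phi> {- 1, 1} f"
      unfolding generated_by_flow_real_def by blast
    interpret periodic_flow_space T \<nu> \<phi>
    proof (intro periodic_flow_space.intro flow_space.intro flow_space_axioms.intro periodic_flow_space_axioms.intro time_set_axioms)
      show "standard_borel \<nu>" "sigma_finite_measure \<nu>" "measurable_flow T \<nu> \<phi>" "nonsingular_flow T \<nu> \<phi>"
        using gen unfolding generated_by_flow_real_def standard_lebesgue_def by blast+
      show "AE s in \<nu>. \<exists>p\<in>T - {0}. \<phi> p s = s" using gen unfolding periodic_flow_def by blast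
    qed
    have X: "stoch_process T P X" using stat by (simp add: stationary_def)
    let ?Q = "path_measure T P X"
    let ?X2 = "\<lambda>t (\<omega> :: (real \<Rightarrow> real) \<times> (real \<Rightarrow> real)). snd \<omega> t"
    have kernel: "kernel_Lalpha T \<alpha> \<nu> f" using f by (simp add: stable_integral_real_def)
    have one: "1 \<in> {- 1, 1 :: real}" and unit: "\<And>w. w \<in> {- 1, 1 :: real} \<Longrightarrow> norm w = 1" by auto
    obtain \<sigma> :: "real measure" and q b g where
      data: "cyclic_data T \<alpha> {- 1, 1} \<sigma> q b g" and
      K: "kernel_Lalpha T \<alpha> (strip_measure T \<sigma> q) (cyclic_kernel q b g)" and
      eq: "\<forall>J \<theta>. finite J \<and> J \<subseteq> T \<longrightarrow> (\<integral>s. norm (\<Sum>t\<in>J. \<theta> t * f t s) powr \<alpha> \<partial>\<nu>) =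
        (\<integral>x. norm (\<Sum>t\<in>J. \<theta> t * cyclic_kernel q b g t x) powr \<alpha> \<partial>strip_measure T \<sigma> q)"
      using cyclic_representation[OF assms(2) kernel fk sets_spheres(1) one unit] by blast
    have "stable_integral_real T \<alpha> ?Q ?X2 (strip_measure T \<sigma> q) (cyclic_kernel q b g)"
      unfolding stable_integral_real_def
    proof (intro conjI allI impI stoch_process_path[OF X] K)
      fix J and \<theta> :: "real \<Rightarrow> real" assume J: "finite J \<and> J \<subseteq> T"
      have [measurable]: "(\<lambda>\<omega>. snd \<omega> t) \<in> borel_measurable ?Q" if "t \<in> J" for t
        using J that by (intro path_coordinate_measurable[OF X]) auto
      \<comment> \<open>The second coordinate inherits the characteristic functions of
        \<open>X\<close>; equality of the norms then replaces \<open>f\<close> by the cyclic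
        kernel.\<close>
      have "(\<integral>\<omega>. exp (\<i> * complex_of_real (\<Sum>t\<in>J. \<theta> t * snd \<omega> t)) \<partial>?Q) =
          (\<integral>\<omega>. exp (\<i> * complex_of_real (\<Sum>t\<in>J. \<theta> t * X t \<omega>)) \<partial>P)"
      proof -
        have "(\<lambda>\<omega>. exp (\<i> * complex_of_real (\<Sum>t\<in>J. \<theta> t * snd \<omega> t))) \<in> borel_measurable ?Q"
          by measurable
        note integral_path_measure[OF X this]
        moreover have "(\<Sum>t\<in>J. \<theta> t * snd (\<lambda>t\<in>T. 0 :: real, \<lambda>t\<in>T. X t \<omega>) t) = (\<Sum>t\<in>J. \<theta> t * X t \<omega>)" for \<omega>
          using J by (intro sum.cong) auto
        ultimately show ?thesis by (simp only:)
      qed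
      also have "\<dots> = complex_of_real (exp (- (\<integral>s. \<bar>\<Sum>t\<in>J. \<theta> t * f t s\<bar> powr \<alpha> \<partial>\<nu>)))"
        using f J by (simp add: stable_integral_real_def)
      finally show "(\<integral>\<omega>. exp (\<i> * complex_of_real (\<Sum>t\<in>J. \<theta> t * snd \<omega> t)) \<partial>?Q) =
          complex_of_real (exp (- (\<integral>s. \<bar>\<Sum>t\<in>J. \<theta> t * cyclic_kernel q b g t s\<bar> powr \<alpha> \<partial>strip_measure T \<sigma> q)))"
        using eq[rule_format, OF J, of \<theta>] by simp
    qed
    then show "\<exists>(Q :: ((real \<Rightarrow> real) \<times> (real \<Rightarrow> real)) measure) X1 X2
          (\<eta> :: nat measure) (\<sigma> :: real measure) q b g.
          stationary T Q X1 \<and> stationary T Q X2 \<and> indep_processes T Q X1 X2 \<and>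
          same_fdd T P X Q (\<lambda>t \<omega>. X1 t \<omega> + X2 t \<omega>) \<and>
          finite_measure \<eta> \<and> sets \<eta> = sets (count_space {1, 2}) \<and>
          stable_integral_real T \<alpha> Q X1 \<eta> (spectral_kernel_real T) \<and>
          cyclic_data T \<alpha> {-1, 1} \<sigma> q b g \<and>
          stable_integral_real T \<alpha> Q X2 (strip_measure T \<sigma> q) (cyclic_kernel q b g)"
      using stationary_zero[OF prob_space_path_measure[OF X], of T] stationary_path[OF X stat time_closed(4)]
        indep_processes_zero[OF stoch_process_path[OF X]] same_fdd_path[OF X] data
        stable_integral_real_zero[OF prob_space_path_measure[OF X], of \<alpha>]
      by (intro exI[of _ ?Q] exI[of _ "\<lambda>t \<omega>. 0"] exI[of _ ?X2] exI[of _ "null_measure (count_space {1, 2})"]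
          exI[of _ \<sigma>] exI[of _ q] exI[of _ b] exI[of _ g] conjI finite_null_measure) simp_all
  next
    assume gen: "generated_by_flow_complex T \<alpha> P Y \<nu> \<phi> \<and> periodic_flow T \<nu> \<phi>"
    then obtain f where stat: "stationary T P Y" and f: "stable_integral_complex T \<alpha> P Y \<nu> f"
      and fk: "flow_kernel T \<alpha> \<nu> \<phi> {w. cmod w = 1} f"
      unfolding generated_by_flow_complex_def by blast
    interpret periodic_flow_space T \<nu> \<phi>
    proof (intro periodic_flow_space.intro flow_space.intro flow_space_axioms.intro periodic_flow_space_axioms.intro time_set_axioms)
      show "standard_borel \<nu>" "sigma_finite_measure \<nu>" "measurable_flow T \<nu> \<phi>" "nonsingular_flow T \<nu> \<phi>"
        using gen unfolding generated_by_flow_complex_def standard_lebesgue_def by blast+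
      show "AE s in \<nu>. \<exists>p\<in>T - {0}. \<phi> p s = s" using gen unfolding periodic_flow_def by blast
    qed
    have Y: "stoch_process T P Y" using stat by (simp add: stationary_def)
    let ?Q = "path_measure T P Y"
    let ?Y2 = "\<lambda>t (\<omega> :: (real \<Rightarrow> complex) \<times> (real \<Rightarrow> complex)). snd \<omega> t"
    have kernel: "kernel_Lalpha T \<alpha> \<nu> f" using f by (simp add: stable_integral_complex_def)
    have one: "1 \<in> {w. cmod w = 1}" and unit: "\<And>w. w \<in> {w. cmod w = 1} \<Longrightarrow> norm w = 1" by auto
    obtain \<sigma> :: "real measure" and q b g where
      data: "cyclic_data T \<alpha> {w. cmod w = 1} \<sigma> q b g" and
      K: "kernel_Lalpha T \<alpha> (strip_measure T \<sigma> q) (cyclic_kernel q b g)" and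
      eq: "\<forall>J \<theta>. finite J \<and> J \<subseteq> T \<longrightarrow> (\<integral>s. norm (\<Sum>t\<in>J. \<theta> t * f t s) powr \<alpha> \<partial>\<nu>) =
        (\<integral>x. norm (\<Sum>t\<in>J. \<theta> t * cyclic_kernel q b g t x) powr \<alpha> \<partial>strip_measure T \<sigma> q)"
      using cyclic_representation[OF assms(2) kernel fk sets_spheres(2) one unit] by blast
    have "stable_integral_complex T \<alpha> ?Q ?Y2 (strip_measure T \<sigma> q) (cyclic_kernel q b g)"
      unfolding stable_integral_complex_def
    proof (intro conjI allI impI stoch_process_path[OF Y] K)
      fix J and \<theta> :: "real \<Rightarrow> complex" assume J: "finite J \<and> J \<subseteq> T"
      have [measurable]: "(\<lambda>\<omega>. snd \<omega> t) \<in> borel_measurable ?Q" if "t \<in> J" for t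
        using J that by (intro path_coordinate_measurable[OF Y]) auto
      have "(\<integral>\<omega>. exp (\<i> * complex_of_real (\<Sum>t\<in>J. Re (cnj (\<theta> t) * snd \<omega> t))) \<partial>?Q) =
          (\<integral>\<omega>. exp (\<i> * complex_of_real (\<Sum>t\<in>J. Re (cnj (\<theta> t) * Y t \<omega>))) \<partial>P)"
      proof -
        have "(\<lambda>\<omega>. exp (\<i> * complex_of_real (\<Sum>t\<in>J. Re (cnj (\<theta> t) * snd \<omega> t)))) \<in> borel_measurable ?Q"
          by measurable
        note integral_path_measure[OF Y this]
        moreover have "(\<Sum>t\<in>J. Re (cnj (\<theta> t) * snd (\<lambda>t\<in>T. 0 :: complex, \<lambda>t\<in>T. Y t \<omega>) t)) = (\<Sum>t\<in>J. Re (cnj (\<theta> t) * Y t \<omega>))" for \<omega>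
          using J by (intro sum.cong) auto
        ultimately show ?thesis by (simp only:)
      qed
      also have "\<dots> = complex_of_real (exp (- isotropic_const \<alpha> * (\<integral>s. cmod (\<Sum>t\<in>J. cnj (\<theta> t) * f t s) powr \<alpha> \<partial>\<nu>)))"
        using f J unfolding stable_integral_complex_def by blast
      finally show "(\<integral>\<omega>. exp (\<i> * complex_of_real (\<Sum>t\<in>J. Re (cnj (\<theta> t) * snd \<omega> t))) \<partial>?Q) =
          complex_of_real (exp (- isotropic_const \<alpha> *
            (\<integral>s. cmod (\<Sum>t\<in>J. cnj (\<theta> t) * cyclic_kernel q b g t s) powr \<alpha> \<partial>strip_measure T \<sigma> q)))"
        \<comment> \<open>The complex characteristic function involves conjugated coefficients, so
          the norm identity is applied to these.\<close>
        using eq[rule_format, OF J, of "\<lambda>t. cnj (\<theta> t)"] by simp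
    qed
    then show "\<exists>(Q :: ((real \<Rightarrow> complex) \<times> (real \<Rightarrow> complex)) measure) Y1 Y2
          (\<eta> :: real measure) (\<sigma> :: real measure) q b g.
          stationary T Q Y1 \<and> stationary T Q Y2 \<and> indep_processes T Q Y1 Y2 \<and>
          same_fdd T P Y Q (\<lambda>t \<omega>. Y1 t \<omega> + Y2 t \<omega>) \<and>
          finite_measure \<eta> \<and> sets \<eta> = sets (restrict_space borel (dual_time T)) \<and>
          stable_integral_complex T \<alpha> Q Y1 \<eta> spectral_kernel_complex \<and>
          cyclic_data T \<alpha> {w. cmod w = 1} \<sigma> q b g \<and>
          stable_integral_complex T \<alpha> Q Y2 (strip_measure T \<sigma> q) (cyclic_kernel q b g)"
      using stationary_zero[OF prob_space_path_measure[OF Y], of T] stationary_path[OF Y stat time_closed(4)]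
        indep_processes_zero[OF stoch_process_path[OF Y]] same_fdd_path[OF Y] data
        stable_integral_complex_zero[OF prob_space_path_measure[OF Y], of \<alpha>]
      by (intro exI[of _ ?Q] exI[of _ "\<lambda>t \<omega>. 0"] exI[of _ ?Y2]
          exI[of _ "null_measure (restrict_space borel (dual_time T))"]
          exI[of _ \<sigma>] exI[of _ q] exI[of _ b] exI[of _ g] conjI finite_null_measure) simp_all
  }
qed

end
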